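(* Assume that $\mathcal G_\sigma$ has independent edges, that $\sigma$ has a unique stationary distribution $\pi$, and that $\Delta>0$. Define $f:[0,\infty)\to\mathbb R$ by $f(s)=s+2n^2\exp\!\left(-\frac{3s^2}{2s+6\Delta}\right)$. Then the minimum $\min_{s\ge0}f(s)$ exists, and if $\lambda_{\max}(\bar A)+\min_{s\ge0}f(s)<\delta/\beta$, then the switched $N$-intertwined model $\Sigma$ is almost surely stable.
   Context: Let $n\ge 1$, $\beta>0$, $\delta>0$. Let $\sigma=\{\sigma(t)\}_{t\ge0}$ be a time-homogeneous Markov process with finite state space $\{1,\dots,N\}$, and let $\mathcal G_1,\dots,\mathcal G_N$ be undirected simple graphs on $\{1,\dots,n\}$ with adjacency matrices $A_{\mathcal G_k}$ (symmetric $\{0,1\}$-matrices with zero diagonal); write $\mathcal G_\sigma=\{\mathcal G_{\sigma(t)}\}_{t\ge0}$. The switched $N$-intertwined model $\Sigma$ is $\frac{dp}{dt}=(\beta A_{\mathcal G_{\sigma(t)}}-\delta I)p-\beta P A_{\mathcal G_{\sigma(t)}}p$, $P=\mathrm{diag}(p_1,\dots,p_n)$, $p(0)=p_0\in[0,1]^n$, $\sigma(0)=\sigma_0$. $\Sigma$ is almost surely stable if for every $p_0,\sigma_0$, $P(\lim_{t\to\infty}\|p(t)\|=0)=1$. For distinct $i,j$ let $A_{ij}=\{A_{ij}(t)\}_{t\ge0}$ be the $(i,j)$ entry process of $A_{\mathcal G_{\sigma(t)}}$; $\mathcal G_\sigma$ has independent edges if the processes $\{A_{ij}\}_{i>j}$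 are mutually stochastically independent. $A_{\mathcal G_\pi}$ is the random matrix $A_{\mathcal G_K}$ with $K\sim\pi$; $\bar A=E[A_{\mathcal G_\pi}]$ and $\Delta=\max_{1\le i\le n}\sum_{j=1}^n\bar A_{ij}(1-\bar A_{ij})$. $\lambda_{\max}$ is the largest eigenvalue of a symmetric matrix. *)

theory Defs
  imports "HOL-Probability.Probability"
begin

text \<open>States of the Markov process: a finite type 's (plays the role of {1..N}).
  Vertices: a finite linearly ordered type 'v (plays the role of {1..n}, n = CARD('v)).
  A family of graphs is given by G :: 's => 'v => 'v => bool (edge relation of graph G_k).\<close>

definition simple_graphs :: "('s \<Rightarrow> 'v \<Rightarrow> 'v \<Rightarrow> bool) \<Rightarrow> bool" where
  "simple_graphs G \<longleftrightarrow> (\<forall>k i j. G k i j = G k j i) \<and> (\<forall>k i. \<not> G k i i)"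

definition adj :: "('s \<Rightarrow> 'v \<Rightarrow> 'v \<Rightarrow> bool) \<Rightarrow> 's \<Rightarrow> real^'v^'v" where
  "adj G k = (\<chi> i j. if G k i j then 1 else 0)"

definition lambda_max :: "real^'n^'n \<Rightarrow> real" where
  "lambda_max A = Max {l. \<exists>v. v \<noteq> 0 \<and> A *v v = l *\<^sub>R v}"

definition transition_function :: "(real \<Rightarrow> 's::finite \<Rightarrow> 's \<Rightarrow> real) \<Rightarrow> bool" where
  "transition_function Pt \<longleftrightarrow>
     (\<forall>t\<ge>0. \<forall>i j. Pt t i j \<ge> 0) \<and>
     (\<forall>t\<ge>0. \<forall>i. (\<Sum>j\<in>UNIV. Pt t i j) = 1) \<and>
     (\<forall>i j. Pt 0 i j = (if i = j then 1 else 0)) \<and>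
     (\<forall>s\<ge>0. \<forall>t\<ge>0. \<forall>i j. Pt (s + t) i j = (\<Sum>k\<in>UNIV. Pt s i k * Pt t k j))"

text \<open>sigma is a time-homogeneous Markov process on (M) with transition function Pt,
  with right-continuous (hence piecewise constant from the right) sample paths.
  Markov property stated through finite-dimensional distributions.\<close>
definition markov_process ::
  "'w measure \<Rightarrow> (real \<Rightarrow> 's::finite \<Rightarrow> 's \<Rightarrow> real) \<Rightarrow> ('w \<Rightarrow> real \<Rightarrow> 's) \<Rightarrow> bool" where
  "markov_process M Pt \<sigma> \<longleftrightarrow>
     prob_space M \<and> transition_function Pt \<and>
     (\<forall>t. (\<lambda>\<omega>. \<sigma> \<omega> t) \<in> measurable M (count_space UNIV)) \<and>
     (\<forall>\<omega>\<in>space M. \<forall>t\<ge>0. \<exists>e>0. \<forall>s. t \<le> s \<and> s < t + e \<longrightarrow> \<sigma> \<omega> s = \<sigma> \<omega> t) \<and>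
     (\<forall>ts :: real list. \<forall>is :: 's list. \<forall>t j.
        length ts = length is \<and> ts \<noteq> [] \<and> sorted_wrt (<) ts \<and> 0 \<le> hd ts \<and> last ts < t \<longrightarrow>
        measure M {\<omega>\<in>space M. (\<forall>k<length ts. \<sigma> \<omega> (ts!k) = is!k) \<and> \<sigma> \<omega> t = j}
        = measure M {\<omega>\<in>space M. \<forall>k<length ts. \<sigma> \<omega> (ts!k) = is!k} * Pt (t - last ts) (last is) j)"

definition stationary_distribution :: "(real \<Rightarrow> 's::finite \<Rightarrow> 's \<Rightarrow> real) \<Rightarrow> ('s \<Rightarrow> real) \<Rightarrow> bool" where
  "stationary_distribution Pt \<pi> \<longleftrightarrow>
     (\<forall>k. \<pi> k \<ge> 0) \<and> (\<Sum>k\<in>UNIV. \<pi> k) = 1 \<and>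
     (\<forall>t\<ge>0. \<forall>j. (\<Sum>i\<in>UNIV. \<pi> i * Pt t i j) = \<pi> j)"

definition independent_edges ::
  "'w measure \<Rightarrow> ('s \<Rightarrow> 'v::{finite,linorder} \<Rightarrow> 'v \<Rightarrow> bool) \<Rightarrow> ('w \<Rightarrow> real \<Rightarrow> 's) \<Rightarrow> bool" where
  "independent_edges M G \<sigma> \<longleftrightarrow>
     prob_space.indep_vars M (\<lambda>_. PiM {0..} (\<lambda>_. count_space (UNIV :: real set)))
       (\<lambda>(i, j) \<omega>. restrict (\<lambda>t. adj G (\<sigma> \<omega> t) $ i $ j) {0..})
       {(i, j). j < i}"

definition Abar :: "('s::finite \<Rightarrow> 'v \<Rightarrow> 'v \<Rightarrow> bool) \<Rightarrow> ('s \<Rightarrow> real) \<Rightarrow> real^'v^'v" where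
  "Abar G \<pi> = (\<Sum>k\<in>UNIV. \<pi> k *\<^sub>R adj G k)"

definition Delta :: "real^'v::finite^'v \<Rightarrow> real" where
  "Delta A = Max (range (\<lambda>i. \<Sum>j\<in>UNIV. A $ i $ j * (1 - A $ i $ j)))"

definition nimfa_rhs :: "real \<Rightarrow> real \<Rightarrow> real^'v::finite^'v \<Rightarrow> real^'v \<Rightarrow> real^'v" where
  "nimfa_rhs \<beta> \<delta> A p = (\<beta> *\<^sub>R A - \<delta> *\<^sub>R mat 1) *v p - \<beta> *\<^sub>R ((\<chi> i j. if i = j then p $ i else 0) *v (A *v p))"

text \<open>x is a solution on [0,oo) of dx/dt = nimfa_rhs(A_{sigma(t)}, x) with x(0) = p0 (Caratheodory sense,
  i.e. integral equation; sigma is piecewise constant).\<close>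
definition switched_solution ::
  "real \<Rightarrow> real \<Rightarrow> ('s \<Rightarrow> 'v \<Rightarrow> 'v \<Rightarrow> bool) \<Rightarrow> (real \<Rightarrow> 's) \<Rightarrow> real^'v \<Rightarrow> (real \<Rightarrow> real^'v) \<Rightarrow> bool" where
  "switched_solution \<beta> \<delta> G sig p0 x \<longleftrightarrow>
     x 0 = p0 \<and>
     (\<forall>t\<ge>0. ((\<lambda>s. nimfa_rhs \<beta> \<delta> (adj G (sig s)) (x s)) has_integral (x t - p0)) {0..t})"

definition as_stable ::
  "'w measure \<Rightarrow> real \<Rightarrow> real \<Rightarrow> ('s \<Rightarrow> 'v::finite \<Rightarrow> 'v \<Rightarrow> bool) \<Rightarrow> ('w \<Rightarrow> real \<Rightarrow> 's) \<Rightarrow> bool" where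
  "as_stable M \<beta> \<delta> G \<sigma> \<longleftrightarrow>
     (\<forall>p0 :: real^'v. (\<forall>i. 0 \<le> p0 $ i \<and> p0 $ i \<le> 1) \<longrightarrow>
       (\<forall>p :: 'w \<Rightarrow> real \<Rightarrow> real^'v.
          (\<forall>\<omega>\<in>space M. switched_solution \<beta> \<delta> G (\<sigma> \<omega>) p0 (p \<omega>)) \<longrightarrow>
          (AE \<omega> in M. ((\<lambda>t. norm (p \<omega> t)) \<longlongrightarrow> 0) at_top)))"

end

theory Submission
  imports Defs
begin

text \<open>
  Along a path the infection probabilities stay nonnegative, so the quadratic term only helps and
  \<open>|p(t)|\<^sup>2 \<le> |p(0)|\<^sup>2 exp (2 \<integral> \<beta> \<Lambda>(\<sigma>(s)) - \<delta> ds)\<close>, where \<open>\<Lambda> k\<close> is \<open>\<lambda>\<^sub>m\<^sub>a\<^sub>x\<close> of the mean matrix plus the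
  largest eigenvalue of \<open>X k\<close>, the centred adjacency matrix. Uniqueness of the stationary distribution
  gives geometric mixing on the states reachable from the initial one (Doeblin), hence the ergodic
  theorem for the exponent, by a second moment estimate along the times \<open>T n\<^sup>2\<close>. Mixing also transfers
  independence of the edges from the law of \<open>\<sigma>(t)\<close> to \<open>\<pi>\<close>.

  It remains to bound the mean of the largest eigenvalue of \<open>X\<close>. Since the entries are independent, the matrix
  Bernstein inequality follows without Lieb's theorem by the moment method: a closed walk contributes to
  \<open>E tr X\<^sup>K\<close> only if it crosses every edge at least twice, and a walk is determined by its starting
  point, the partition of time induced by its edges and, for each edge, the vertex reached at its
  first crossing, which costs at most \<open>\<Delta>\<close>. This gives \<open>n\<close> times the \<open>K\<close>-th moment of a centred
  Poisson variable of mean \<open>\<Delta>\<close>.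
\<close>

section \<open>Extremal eigenvalues of symmetric matrices\<close>

lemma symmetric_inner_matrix_vector:
  fixes A :: "real^'n^'n"
  assumes "transpose A = A"
  shows "x \<bullet> (A *v y) = (A *v x) \<bullet> y"
  using dot_lmul_matrix[of x A y] assms by (metis transpose_matrix_vector)

lemma symmetric_rayleigh_eigenvector:
  fixes A :: "real^'n^'n"
  assumes sym: "transpose A = A"
  obtains v l where "norm v = 1" "A *v v = l *\<^sub>R v" "\<And>w. w \<bullet> (A *v w) \<le> l * (norm w)\<^sup>2"
proof -
  have "compact (sphere (0::real^'n) 1)" "sphere (0::real^'n) 1 \<noteq> {}" by auto
  moreover have "continuous_on (sphere 0 1) (\<lambda>w. w \<bullet> (A *v w))"
    by (intro continuous_intros)
  ultimately obtain v where v: "v \<in> sphere 0 1"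
    and max: "\<And>w. w \<in> sphere 0 1 \<Longrightarrow> w \<bullet> (A *v w) \<le> v \<bullet> (A *v v)"
    using continuous_attains_sup[of "sphere (0::real^'n) 1" "\<lambda>w. w \<bullet> (A *v w)"] by blast
  define l where "l = v \<bullet> (A *v v)"
  have nv: "norm v = 1" using v by simp
  have ray: "w \<bullet> (A *v w) \<le> l * (norm w)\<^sup>2" for w
  proof (cases "w = 0")
    case False
    have "(w /\<^sub>R norm w) \<bullet> (A *v (w /\<^sub>R norm w)) \<le> l"
      unfolding l_def using False by (intro max) simp
    then have "(w \<bullet> (A *v w)) / (norm w)\<^sup>2 \<le> l"
      by (simp add: matrix_vector_mult_scaleR power2_eq_square divide_simps)
    then show ?thesis using False by (simp add: divide_simps split: if_splits)
  qed simp
  define u where "u = l *\<^sub>R v - A *v v"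
  \<comment> \<open>The form \<open>l |w|\<^sup>2 - w \<bullet> A w\<close> is nonnegative and vanishes at \<open>v\<close>, so its first variation
    at \<open>v\<close> in the direction \<open>-u\<close> cannot be negative.\<close>
  have "u \<bullet> u = 0"
  proof (rule ccontr)
    assume "u \<bullet> u \<noteq> 0"
    then have upos: "u \<bullet> u > 0" by simp
    define c where "c = \<bar>l * (u \<bullet> u) - u \<bullet> (A *v u)\<bar> + 1"
    have cpos: "c > 0" unfolding c_def by simp
    define e where "e = (u \<bullet> u) / c"
    have epos: "e > 0" unfolding e_def using upos cpos by simp
    have vAu: "v \<bullet> (A *v u) = u \<bullet> (A *v v)"
      using symmetric_inner_matrix_vector[OF sym, of v u] by (simp add: inner_commute)
    have vv: "v \<bullet> v = 1" using nv by (simp add: dot_square_norm)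
    have "u \<bullet> u = l * (u \<bullet> v) - u \<bullet> (A *v v)"
      by (subst (2) u_def) (simp add: inner_diff_right)
    then have uAv: "u \<bullet> (A *v v) = l * (u \<bullet> v) - u \<bullet> u" by simp
    have "0 \<le> l * (norm (v - e *\<^sub>R u))\<^sup>2 - (v - e *\<^sub>R u) \<bullet> (A *v (v - e *\<^sub>R u))"
      using ray[of "v - e *\<^sub>R u"] by simp
    also have "\<dots> = - 2 * e * (u \<bullet> u) + e\<^sup>2 * (l * (u \<bullet> u) - u \<bullet> (A *v u))"
    proof -
      have "l * (norm (v - e *\<^sub>R u))\<^sup>2 - (v - e *\<^sub>R u) \<bullet> (A *v (v - e *\<^sub>R u))
        = l * (1 - 2 * e * (u \<bullet> v) + e\<^sup>2 * (u \<bullet> u))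
          - (l - e * (u \<bullet> (A *v v)) - e * (v \<bullet> (A *v u)) + e\<^sup>2 * (u \<bullet> (A *v u)))"
        unfolding power2_norm_eq_inner
        by (simp add: matrix_vector_mult_diff_distrib matrix_vector_mult_scaleR inner_diff_left inner_diff_right
          inner_commute[of v u] vv l_def[symmetric] algebra_simps power2_eq_square)
      then show ?thesis unfolding vAu uAv by (simp add: algebra_simps)
    qed
    also have "\<dots> \<le> - 2 * e * (u \<bullet> u) + e\<^sup>2 * c"
      unfolding c_def by (intro add_left_mono mult_left_mono) auto
    also have "\<dots> = - e * (u \<bullet> u)"
      unfolding e_def using cpos by (simp add: power2_eq_square field_simps)
    also have "\<dots> < 0" using epos upos by simp
    finally show False by simp
  qed
  then have "A *v v = l *\<^sub>R v" unfolding u_def by simp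
  then show thesis using that nv ray by blast
qed

lemma symmetric_eigenvalues_finite:
  fixes A :: "real^'n^'n"
  assumes sym: "transpose A = A"
  shows "finite {l. \<exists>v. v \<noteq> 0 \<and> A *v v = l *\<^sub>R v}" (is "finite ?E")
proof -
  have "\<forall>l\<in>?E. \<exists>v. v \<noteq> 0 \<and> A *v v = l *\<^sub>R v" by blast
  from bchoice[OF this] obtain v where v: "\<And>l. l \<in> ?E \<Longrightarrow> v l \<noteq> 0 \<and> A *v v l = l *\<^sub>R v l"
    by blast
  have orth: "v a \<bullet> v b = 0" if "a \<in> ?E" "b \<in> ?E" "a \<noteq> b" for a b
  proof -
    have "b * (v a \<bullet> v b) = a * (v a \<bullet> v b)"
      using symmetric_inner_matrix_vector[OF sym, of "v a" "v b"] v[OF that(1)] v[OF that(2)] by simp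
    then show ?thesis using that(3) by simp
  qed
  have inj: "inj_on v ?E"
  proof (rule inj_onI, rule ccontr)
    fix a b assume "a \<in> ?E" "b \<in> ?E" "v a = v b" "a \<noteq> b"
    then show False using orth[of a b] v[of a] by simp
  qed
  have "pairwise orthogonal (v ` ?E)"
    unfolding pairwise_image by (rule pairwiseI) (use orth in \<open>auto simp: orthogonal_def\<close>)
  moreover have "0 \<notin> v ` ?E"
  proof
    assume "0 \<in> v ` ?E"
    then obtain l where "l \<in> ?E" "v l = 0" by (rule imageE) simp
    then show False using v[of l] by simp
  qed
  ultimately have "independent (v ` ?E)" by (rule pairwise_orthogonal_independent)
  then have "finite (v ` ?E)" by (rule finiteI_independent)
  then show ?thesis using inj by (rule finite_imageD)
qed

lemma lambda_max_rayleigh: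
  fixes A :: "real^'n^'n"
  assumes "transpose A = A"
  shows "w \<bullet> (A *v w) \<le> lambda_max A * (norm w)\<^sup>2"
proof -
  obtain v l where v: "norm v = 1" "A *v v = l *\<^sub>R v" and ray: "\<And>w. w \<bullet> (A *v w) \<le> l * (norm w)\<^sup>2"
    using symmetric_rayleigh_eigenvector[OF assms] by blast
  have "v \<noteq> 0" using v(1) by auto
  then have "l \<le> lambda_max A"
    unfolding lambda_max_def using symmetric_eigenvalues_finite[OF assms] v(2) by (intro Max_ge) auto
  then show ?thesis using ray[of w] by (smt (verit) mult_right_mono zero_le_power2)
qed

section \<open>Moments of random matrices with independent entries\<close>

fun matrix_entry_pow :: "real^'v^'v \<Rightarrow> nat \<Rightarrow> 'v \<Rightarrow> 'v \<Rightarrow> real" where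
  "matrix_entry_pow X 0 i j = (if i = j then 1 else 0)"
| "matrix_entry_pow X (Suc K) i j = (\<Sum>l\<in>UNIV. X $ i $ l * matrix_entry_pow X K l j)"

lemma matrix_entry_pow_add:
  "matrix_entry_pow X (a + b) i j = (\<Sum>l\<in>UNIV. matrix_entry_pow X a i l * matrix_entry_pow X b l j)"
proof (induction a arbitrary: i)
  case 0
  have "(\<Sum>l\<in>UNIV. (if i = l then 1 else 0) * matrix_entry_pow X b l j)
      = (\<Sum>l\<in>UNIV. if l = i then matrix_entry_pow X b l j else 0)"
    by (intro sum.cong) auto
  then show ?case by simp
next
  case (Suc a)
  have "matrix_entry_pow X (Suc a + b) i j
      = (\<Sum>l\<in>UNIV. \<Sum>l'\<in>UNIV. X $ i $ l * matrix_entry_pow X a l l' * matrix_entry_pow X b l' j)"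
    by (simp add: Suc sum_distrib_left mult.assoc)
  also have "\<dots> = (\<Sum>l'\<in>UNIV. \<Sum>l\<in>UNIV. X $ i $ l * matrix_entry_pow X a l l' * matrix_entry_pow X b l' j)"
    by (rule sum.swap)
  finally show ?case by (simp add: sum_distrib_right)
qed

lemma matrix_entry_pow_sym:
  assumes "\<And>i j. X $ i $ j = X $ j $ i"
  shows "matrix_entry_pow X a i j = matrix_entry_pow X a j i"
proof (induction a arbitrary: i j)
  case (Suc a)
  have one: "matrix_entry_pow X 1 l i = X $ i $ l" for l
    using assms by (simp add: if_distrib[of "(*) _"] cong: if_cong)
  have "matrix_entry_pow X (Suc a) j i = (\<Sum>l\<in>UNIV. matrix_entry_pow X a j l * matrix_entry_pow X 1 l i)"
    using matrix_entry_pow_add[of X a 1 j i] by simp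
  then show ?case unfolding one using Suc by (simp add: mult.commute)
qed simp

lemma eigenvalue_power_le_trace:
  fixes X :: "real^'v^'v"
  assumes sym: "\<And>i j. X $ i $ j = X $ j $ i" and v: "norm v = 1" "X *v v = l *\<^sub>R v"
  shows "l ^ (2 * m) \<le> (\<Sum>i\<in>UNIV. matrix_entry_pow X (2 * m) i i)"
proof -
  have vi: "(\<Sum>j\<in>UNIV. X $ i $ j * v $ j) = l * v $ i" for i
    using v(2) by (simp add: vec_eq_iff matrix_vector_mult_def)
  have ev: "(\<Sum>j\<in>UNIV. matrix_entry_pow X m i j * v $ j) = l ^ m * v $ i" for i
  proof (induction m arbitrary: i)
    case 0
    have "(\<Sum>j\<in>UNIV. (if i = j then 1 else 0) * v $ j) = (\<Sum>j\<in>UNIV. if j = i then v $ j else 0)"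
      by (intro sum.cong) auto
    then show ?case by simp
  next
    case (Suc m)
    have "(\<Sum>j\<in>UNIV. matrix_entry_pow X (Suc m) i j * v $ j)
        = (\<Sum>j\<in>UNIV. \<Sum>l\<in>UNIV. X $ i $ l * (matrix_entry_pow X m l j * v $ j))"
      by (simp add: sum_distrib_right mult.assoc)
    also have "\<dots> = (\<Sum>l\<in>UNIV. \<Sum>j\<in>UNIV. X $ i $ l * (matrix_entry_pow X m l j * v $ j))"
      by (rule sum.swap)
    also have "\<dots> = (\<Sum>k\<in>UNIV. l ^ m * (X $ i $ k * v $ k))"
      by (simp add: Suc mult.left_commute flip: sum_distrib_left)
    also have "\<dots> = l ^ Suc m * v $ i"
      by (simp add: vi flip: sum_distrib_left)
    finally show ?case .
  qed
  have vv: "(\<Sum>j\<in>UNIV. (v $ j)\<^sup>2) = 1"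
    using v(1) by (simp add: norm_eq_1 inner_vec_def power2_eq_square)
  have "(l ^ m * v $ i)\<^sup>2 \<le> matrix_entry_pow X (2 * m) i i" for i
  proof -
    have "(l ^ m * v $ i)\<^sup>2 \<le> (\<Sum>j\<in>UNIV. (matrix_entry_pow X m i j)\<^sup>2) * (\<Sum>j\<in>UNIV. (v $ j)\<^sup>2)"
      unfolding ev[symmetric] by (rule Cauchy_Schwarz_ineq_sum)
    also have "\<dots> = matrix_entry_pow X (2 * m) i i"
      unfolding vv mult_2 matrix_entry_pow_add
      by (simp add: power2_eq_square) (metis matrix_entry_pow_sym[OF sym])
    finally show ?thesis .
  qed
  then have "(\<Sum>i\<in>UNIV. (l ^ m * v $ i)\<^sup>2) \<le> (\<Sum>i\<in>UNIV. matrix_entry_pow X (2 * m) i i)"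
    by (rule sum_mono)
  then show ?thesis
    by (simp add: power_mult_distrib vv flip: sum_distrib_left power_mult mult.commute[of m 2])
qed

text \<open>Weighted count of the \<open>K\<close>-step continuations of a walk that has so far crossed \<open>u\<close> edges
  exactly once and \<open>b\<close> edges at least twice, where no edge may be left crossed only once: a step
  uses a new edge (total weight at most \<open>D\<close>) or one of the old edges.\<close>

fun walk_bound :: "real \<Rightarrow> nat \<Rightarrow> nat \<Rightarrow> nat \<Rightarrow> real" where
  "walk_bound D 0 u b = (if u = 0 then 1 else 0)"
| "walk_bound D (Suc K) u b = D * walk_bound D K (Suc u) b
     + real u * walk_bound D K (u - 1) (Suc b) + real b * walk_bound D K u b"

lemma walk_bound_nonneg: "D \<ge> 0 \<Longrightarrow> walk_bound D K u b \<ge> 0"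
  by (induction K arbitrary: u b) auto

lemma walk_bound_generating_function:
  fixes D \<theta> :: real
  assumes D: "D \<ge> 0" and "\<theta> \<ge> 0"
  shows "(\<Sum>K\<le>N. \<theta> ^ K / fact K * walk_bound D K u b)
    \<le> exp (D * (exp \<theta> - 1 - \<theta>)) * (exp \<theta> - 1) ^ u * exp \<theta> ^ b"
  using \<open>\<theta> \<ge> 0\<close>
proof (induction N arbitrary: u b \<theta>)
  case 0
  have "exp (D * (exp \<theta> - 1 - \<theta>)) \<ge> 1" using mult_nonneg_nonneg[OF D, of "exp \<theta> - 1 - \<theta>"] exp_ge_add_one_self[of \<theta>] by simp
  moreover have "exp \<theta> ^ b \<ge> 1" using 0 by (intro one_le_power) auto
  ultimately have "exp (D * (exp \<theta> - 1 - \<theta>)) * exp \<theta> ^ b \<ge> 1"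
    by (metis mult_mono' mult_1 zero_le_one)
  then show ?case using 0 by simp
next
  case (Suc N)
  define F where "F \<theta> u b = exp (D * (exp \<theta> - 1 - \<theta>)) * (exp \<theta> - 1) ^ u * exp \<theta> ^ b" for \<theta> u b
  define S where "S N u b \<theta> = (\<Sum>K\<le>N. \<theta> ^ K / fact K * walk_bound D K u b)" for N u b \<theta>
  define S' where "S' u b \<theta> = D * S N (Suc u) b \<theta> + real u * S N (u - 1) (Suc b) \<theta> + real b * S N u b \<theta>" for u b \<theta>
  define F' where "F' u b \<theta> = D * F \<theta> (Suc u) b + real u * F \<theta> (u - 1) (Suc b) + real b * F \<theta> u b" for u b \<theta>
  have S_Suc: "S (Suc N) u b \<theta> = walk_bound D 0 u b + (\<Sum>K\<le>N. \<theta> ^ Suc K / fact (Suc K) * walk_bound D (Suc K) u b)" for \<theta>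
    unfolding S_def by (subst sum.atMost_Suc_shift) simp
  have dS: "(S (Suc N) u b has_real_derivative S' u b \<theta>) (at \<theta>)" for \<theta>
  proof -
    have "((\<lambda>\<theta>. walk_bound D 0 u b + (\<Sum>K\<le>N. \<theta> ^ Suc K / fact (Suc K) * walk_bound D (Suc K) u b))
       has_real_derivative (\<Sum>K\<le>N. \<theta> ^ K / fact K * walk_bound D (Suc K) u b)) (at \<theta>)"
    proof (rule DERIV_cong)
      show "((\<lambda>\<theta>. walk_bound D 0 u b + (\<Sum>K\<le>N. \<theta> ^ Suc K / fact (Suc K) * walk_bound D (Suc K) u b))
       has_real_derivative (0 + (\<Sum>K\<le>N. real (Suc K) * \<theta> ^ K / fact (Suc K) * walk_bound D (Suc K) u b))) (at \<theta>)"
        using DERIV_pow[of "Suc _"]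
        by (intro derivative_intros DERIV_sum DERIV_cmult_right DERIV_cdivide) simp
    qed (auto intro!: sum.cong simp: fact_Suc simp del: of_nat_Suc)
    also have "(\<Sum>K\<le>N. \<theta> ^ K / fact K * walk_bound D (Suc K) u b) = S' u b \<theta>"
      unfolding S'_def S_def by (simp add: sum_distrib_left sum.distrib algebra_simps)
    finally show ?thesis using S_Suc by presburger
  qed
  have dF: "((\<lambda>\<theta>. F \<theta> u b) has_real_derivative F' u b \<theta>) (at \<theta>)" for \<theta>
  proof -
    have e1: "((\<lambda>\<theta>. exp (D * (exp \<theta> - 1 - \<theta>))) has_real_derivative exp (D * (exp \<theta> - 1 - \<theta>)) * (D * (exp \<theta> - 1))) (at \<theta>)"
      by (auto intro!: derivative_eq_intros)
    have e2: "((\<lambda>\<theta>. (exp \<theta> - 1) ^ u) has_real_derivative real u * (exp \<theta> - 1) ^ (u - 1) * exp \<theta>) (at \<theta>)"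
      by (auto intro!: derivative_eq_intros)
    have e3: "((\<lambda>\<theta>. exp \<theta> ^ b) has_real_derivative real b * exp \<theta> ^ b) (at \<theta>)"
      by (rule DERIV_cong[OF DERIV_power[OF DERIV_exp]]) (cases b; simp)
    show ?thesis unfolding F_def F'_def
      by (rule DERIV_cong[OF DERIV_mult[OF DERIV_mult[OF e1 e2] e3]]) (simp add: algebra_simps)
  qed
  have le: "S' u b \<theta> \<le> F' u b \<theta>" if "\<theta> \<ge> 0" for \<theta>
    unfolding S'_def F'_def S_def F_def using D that
    by (intro add_mono mult_left_mono Suc.IH) auto
  have "F 0 u b - S (Suc N) u b 0 \<le> F \<theta> u b - S (Suc N) u b \<theta>"
  proof (rule DERIV_nonneg_imp_nondecreasing[OF Suc.prems])
    fix x :: real assume "0 \<le> x"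
    then show "\<exists>y. ((\<lambda>\<theta>. F \<theta> u b - S (Suc N) u b \<theta>) has_real_derivative y) (at x) \<and> 0 \<le> y"
      using DERIV_diff[OF dF dS, of x] le[of x] by (intro exI[of _ "F' u b x - S' u b x"]) simp
  qed
  moreover have "F 0 u b = S (Suc N) u b 0"
    unfolding S_Suc F_def by simp
  ultimately show ?case unfolding S_def F_def by simp
qed

text \<open>Independence of the entries below the diagonal is recorded only through mixed moments.\<close>

locale independent_entries =
  fixes \<pi> :: "'s::finite \<Rightarrow> real" and X :: "'s \<Rightarrow> ((real, 'v::{finite,linorder}) vec, 'v) vec" and D :: real
  assumes prob: "\<And>k. \<pi> k \<ge> 0" "(\<Sum>k\<in>UNIV. \<pi> k) = 1"
    and sym: "\<And>k i j. X k $ i $ j = X k $ j $ i"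
    and diag: "\<And>k i. X k $ i $ i = 0"
    and bounded: "\<And>k i j. \<bar>X k $ i $ j\<bar> \<le> 1"
    and mean: "\<And>i j. (\<Sum>k\<in>UNIV. \<pi> k * X k $ i $ j) = 0"
    and row_variance: "\<And>i. (\<Sum>j\<in>UNIV. \<Sum>k\<in>UNIV. \<pi> k * (X k $ i $ j)\<^sup>2) \<le> D"
    and mixed_moments: "\<And>m. (\<Sum>k\<in>UNIV. \<pi> k * (\<Prod>e\<in>{(i, j). j < i}. (X k $ fst e $ snd e) ^ m e))
      = (\<Prod>e\<in>{(i, j). j < i}. \<Sum>k\<in>UNIV. \<pi> k * (X k $ fst e $ snd e) ^ m e)"
begin

definition var :: "'v \<times> 'v \<Rightarrow> real" where
  "var e = (\<Sum>k\<in>UNIV. \<pi> k * (X k $ fst e $ snd e)\<^sup>2)"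

definition edges :: "('v \<times> 'v) set" where
  "edges = {(i, j). j < i}"

definition edge :: "'v \<Rightarrow> 'v \<Rightarrow> 'v \<times> 'v" where
  "edge i j = (max i j, min i j)"

lemma edge_in_edges: "i \<noteq> j \<Longrightarrow> edge i j \<in> edges"
  by (auto simp: edge_def edges_def max_def min_def)

lemma entry_edge: "X k $ fst (edge i j) $ snd (edge i j) = X k $ i $ j"
  using sym[of k i j] by (auto simp: edge_def max_def min_def)

lemma edge_inj: "edge i j = edge i j' \<Longrightarrow> j = j'"
  by (auto simp: edge_def max_def min_def split: if_splits)

lemma var_nonneg: "var e \<ge> 0"
  unfolding var_def using prob by (intro sum_nonneg) auto

lemma D_nonneg: "D \<ge> 0"
proof -
  have "0 \<le> (\<Sum>j\<in>UNIV. \<Sum>k\<in>UNIV. \<pi> k * (X k $ undefined $ j)\<^sup>2)"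
    using prob by (intro sum_nonneg) auto
  then show ?thesis using row_variance[of undefined] by linarith
qed

lemma moment_le_var:
  assumes "m \<ge> 2"
  shows "\<bar>\<Sum>k\<in>UNIV. \<pi> k * (X k $ i $ j) ^ m\<bar> \<le> var (i, j)"
proof -
  have "\<bar>\<pi> k * (X k $ i $ j) ^ m\<bar> \<le> \<pi> k * (X k $ i $ j)\<^sup>2" for k
  proof -
    have "\<bar>X k $ i $ j\<bar> ^ m \<le> \<bar>X k $ i $ j\<bar> ^ 2"
      using assms bounded by (intro power_decreasing) auto
    then show ?thesis using prob(1)[of k] by (auto simp: abs_mult power_abs intro!: mult_left_mono)
  qed
  then have "(\<Sum>k\<in>UNIV. \<bar>\<pi> k * (X k $ i $ j) ^ m\<bar>) \<le> var (i, j)"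
    unfolding var_def fst_conv snd_conv by (rule sum_mono)
  then show ?thesis by (rule order_trans[OF sum_abs])
qed

definition weight :: "('v \<times> 'v \<Rightarrow> nat) \<Rightarrow> real" where
  "weight m = (\<Prod>e\<in>{e\<in>edges. m e > 0}. var e)"

lemma weight_nonneg: "weight m \<ge> 0"
  unfolding weight_def by (intro prod_nonneg) (simp add: var_nonneg)

lemma product_moment_bound:
  "\<bar>\<Sum>k\<in>UNIV. \<pi> k * (\<Prod>e\<in>edges. (X k $ fst e $ snd e) ^ m e)\<bar>
    \<le> weight m * (if card {e\<in>edges. m e = 1} = 0 then 1 else 0)"
proof (cases "{e\<in>edges. m e = 1} = {}")
  case True
  have "\<bar>\<Sum>k\<in>UNIV. \<pi> k * (X k $ fst e $ snd e) ^ m e\<bar> \<le> (if m e > 0 then var e else 1)"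
    if "e \<in> edges" for e
  proof (cases "m e = 0")
    case True
    then show ?thesis using prob by simp
  next
    case False
    then have "m e \<ge> 2" using \<open>{e\<in>edges. m e = 1} = {}\<close> that by (metis (mono_tags, lifting) One_nat_def empty_iff
          less_2_cases_iff linorder_not_less mem_Collect_eq)
    then show ?thesis using moment_le_var[of "m e" "fst e" "snd e"] by simp
  qed
  then have "(\<Prod>e\<in>edges. \<bar>\<Sum>k\<in>UNIV. \<pi> k * (X k $ fst e $ snd e) ^ m e\<bar>)
      \<le> (\<Prod>e\<in>edges. if m e > 0 then var e else 1)"
    by (intro prod_mono) auto
  also have "\<dots> = weight m"
    unfolding weight_def by (rule prod.inter_filter[symmetric]) simp
  finally show ?thesis
    using True mixed_moments[of m] by (simp add: edges_def[symmetric] abs_prod)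
next
  case False
  then obtain e where e: "e \<in> edges" "m e = 1" by blast
  have "(\<Prod>e\<in>edges. \<Sum>k\<in>UNIV. \<pi> k * (X k $ fst e $ snd e) ^ m e) = 0"
    using e mean[of "fst e" "snd e"] by (intro prod_zero) (auto intro!: bexI[of _ e])
  then have "(\<Sum>k\<in>UNIV. \<pi> k * (\<Prod>e\<in>edges. (X k $ fst e $ snd e) ^ m e)) = 0"
    using mixed_moments[of m] unfolding edges_def by simp
  then show ?thesis using weight_nonneg[of m] by simp
qed

lemma walk_moment_bound:
  "\<bar>\<Sum>k\<in>UNIV. \<pi> k * (\<Prod>e\<in>edges. (X k $ fst e $ snd e) ^ m e) * matrix_entry_pow (X k) K i j\<bar>
    \<le> weight m * walk_bound D K (card {e\<in>edges. m e = 1}) (card {e\<in>edges. m e \<ge> 2})"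
proof (induction K arbitrary: m i)
  case 0
  show ?case
  proof (cases "i = j")
    case True
    then show ?thesis using product_moment_bound[of m] by simp
  qed (use weight_nonneg[of m] in auto)
next
  case (Suc K)
  define u where "u = card {e\<in>edges. m e = 1}"
  define b where "b = card {e\<in>edges. m e \<ge> 2}"
  define w where "w = weight m"
  define new once more where "new = walk_bound D K (Suc u) b" and "once = walk_bound D K (u - 1) (Suc b)"
    and "more = walk_bound D K u b"
  have nn: "w \<ge> 0" "new \<ge> 0" "once \<ge> 0" "more \<ge> 0"
    unfolding w_def new_def once_def more_def using weight_nonneg walk_bound_nonneg[OF D_nonneg] by auto
  define step where "step l = (\<Sum>k\<in>UNIV. \<pi> k * (\<Prod>e\<in>edges. (X k $ fst e $ snd e) ^ m e)
     * (X k $ i $ l * matrix_entry_pow (X k) K l j))" for l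
  have step_bound: "\<bar>step l\<bar> \<le> w * (new * (if l \<noteq> i \<and> m (edge i l) = 0 then var (i, l) else 0)
     + once * (if l \<noteq> i \<and> m (edge i l) = 1 then 1 else 0)
     + more * (if l \<noteq> i \<and> m (edge i l) \<ge> 2 then 1 else 0))" for l
  proof (cases "l = i")
    case True
    then show ?thesis unfolding step_def using diag by simp
  next
    case False
    define e where "e = edge i l"
    have eE: "e \<in> edges" unfolding e_def using edge_in_edges False by metis
    define m' where "m' = m(e := Suc (m e))"
    have fin: "finite edges" by simp
    have prod: "(\<Prod>e\<in>edges. (X k $ fst e $ snd e) ^ m e) * X k $ i $ l
        = (\<Prod>e\<in>edges. (X k $ fst e $ snd e) ^ m' e)" for k
    proof -
      have "(\<Prod>e\<in>edges - {e}. (X k $ fst e $ snd e) ^ m e) = (\<Prod>e\<in>edges - {e}. (X k $ fst e $ snd e) ^ m' e)"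
        unfolding m'_def by (intro prod.cong) auto
      then show ?thesis
        using entry_edge[of k i l] unfolding prod.remove[OF fin eE] e_def[symmetric]
        by (simp add: m'_def)
    qed
    have "step l = (\<Sum>k\<in>UNIV. \<pi> k * (\<Prod>e\<in>edges. (X k $ fst e $ snd e) ^ m' e) * matrix_entry_pow (X k) K l j)"
      unfolding step_def prod[symmetric] by (simp add: mult.assoc)
    then have bound: "\<bar>step l\<bar> \<le> weight m' * walk_bound D K (card {e\<in>edges. m' e = 1}) (card {e\<in>edges. m' e \<ge> 2})"
      using Suc.IH[of m' l] by simp
    consider "m e = 0" | "m e = 1" | "m e \<ge> 2" by linarith
    then show ?thesis
    proof cases
      case 1
      have "{x\<in>edges. m' x > 0} = insert e {x\<in>edges. m x > 0}" "{x\<in>edges. m' x = 1} = insert e {x\<in>edges. m x = 1}"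
        "{x\<in>edges. m' x \<ge> 2} = {x\<in>edges. m x \<ge> 2}"
        using 1 eE by (auto simp: m'_def)
      moreover have "var e = var (i, l)" unfolding var_def e_def by (simp add: entry_edge)
      ultimately have "weight m' = var (i, l) * w" "card {x\<in>edges. m' x = 1} = Suc u" "card {x\<in>edges. m' x \<ge> 2} = b"
        unfolding weight_def w_def u_def b_def using 1 by simp_all
      then show ?thesis using bound 1 False by (simp add: e_def[symmetric] new_def mult_ac)
    next
      case 2
      have "{x\<in>edges. m' x > 0} = {x\<in>edges. m x > 0}" "{x\<in>edges. m' x = 1} = {x\<in>edges. m x = 1} - {e}"
        "{x\<in>edges. m' x \<ge> 2} = insert e {x\<in>edges. m x \<ge> 2}"
        using 2 eE by (auto simp: m'_def)
      then have "weight m' = w" "card {x\<in>edges. m' x = 1} = u - 1" "card {x\<in>edges. m' x \<ge> 2} = Suc b"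
        unfolding weight_def w_def u_def b_def using 2 eE by simp_all
      then show ?thesis using bound 2 False by (simp add: e_def[symmetric] once_def)
    next
      case 3
      have "{x\<in>edges. m' x > 0} = {x\<in>edges. m x > 0}" "{x\<in>edges. m' x = 1} = {x\<in>edges. m x = 1}"
        "{x\<in>edges. m' x \<ge> 2} = {x\<in>edges. m x \<ge> 2}"
        using 3 eE by (auto simp: m'_def)
      then have "weight m' = w" "card {x\<in>edges. m' x = 1} = u" "card {x\<in>edges. m' x \<ge> 2} = b"
        unfolding weight_def w_def u_def b_def by simp_all
      then show ?thesis using bound 3 False by (simp add: e_def[symmetric] more_def)
    qed
  qed
  have "(\<Sum>k\<in>UNIV. \<pi> k * (\<Prod>e\<in>edges. (X k $ fst e $ snd e) ^ m e) * matrix_entry_pow (X k) (Suc K) i j)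
      = (\<Sum>l\<in>UNIV. step l)"
    unfolding step_def matrix_entry_pow.simps sum_distrib_left by (rule sum.swap)
  also have "\<bar>\<dots>\<bar> \<le> (\<Sum>l\<in>UNIV. \<bar>step l\<bar>)" by (rule sum_abs)
  also have "\<dots> \<le> (\<Sum>l\<in>UNIV. w * (new * (if l \<noteq> i \<and> m (edge i l) = 0 then var (i, l) else 0)
     + once * (if l \<noteq> i \<and> m (edge i l) = 1 then 1 else 0)
     + more * (if l \<noteq> i \<and> m (edge i l) \<ge> 2 then 1 else 0)))"
    by (intro sum_mono step_bound)
  also have "\<dots> = w * (new * (\<Sum>l\<in>UNIV. if l \<noteq> i \<and> m (edge i l) = 0 then var (i, l) else 0)
     + once * (\<Sum>l\<in>UNIV. if l \<noteq> i \<and> m (edge i l) = 1 then 1 else 0)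
     + more * (\<Sum>l\<in>UNIV. if l \<noteq> i \<and> m (edge i l) \<ge> 2 then 1 else 0))"
    unfolding sum_distrib_left[symmetric] sum.distrib ..
  also have "\<dots> \<le> w * (new * D + once * real u + more * real b)"
  proof (intro mult_left_mono add_mono nn)
    have "(\<Sum>l\<in>UNIV. if l \<noteq> i \<and> m (edge i l) = 0 then var (i, l) else 0) \<le> (\<Sum>l\<in>UNIV. var (i, l))"
      by (intro sum_mono) (auto simp: var_nonneg)
    also have "\<dots> \<le> D" using row_variance[of i] unfolding var_def by simp
    finally show "(\<Sum>l\<in>UNIV. if l \<noteq> i \<and> m (edge i l) = 0 then var (i, l) else 0) \<le> D" .
    have count: "(\<Sum>l\<in>UNIV. if l \<noteq> i \<and> Q (m (edge i l)) then 1 else 0) \<le> real (card {e\<in>edges. Q (m e)})" for Q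
    proof -
      have "card {l. l \<noteq> i \<and> Q (m (edge i l))} \<le> card {e\<in>edges. Q (m e)}"
        by (rule card_inj_on_le[where f = "edge i"]) (auto intro!: inj_onI edge_in_edges dest: edge_inj)
      then show ?thesis by (simp add: sum.If_cases)
    qed
    show "(\<Sum>l\<in>UNIV. if l \<noteq> i \<and> m (edge i l) = 1 then 1 else 0) \<le> real u"
      unfolding u_def by (rule count)
    show "(\<Sum>l\<in>UNIV. if l \<noteq> i \<and> m (edge i l) \<ge> 2 then 1 else 0) \<le> real b"
      unfolding b_def by (rule count)
  qed
  also have "\<dots> = weight m * walk_bound D (Suc K) u b"
    by (simp add: w_def new_def once_def more_def algebra_simps)
  finally show ?case unfolding u_def b_def .
qed

lemma diagonal_moment_bound:
  "(\<Sum>k\<in>UNIV. \<pi> k * matrix_entry_pow (X k) K i i) \<le> walk_bound D K 0 0"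
proof -
  have "weight (\<lambda>_. 0) = 1" unfolding weight_def by simp
  then show ?thesis using walk_moment_bound[of "\<lambda>_. 0" K i i] by simp
qed

end

lemma exp_minus_linear_bernstein:
  fixes \<theta> :: real
  assumes "\<theta> \<ge> 0"
  shows "(1 - \<theta> / 3) * (exp \<theta> - 1 - \<theta>) \<le> \<theta>\<^sup>2 / 2"
proof -
  define g where "g x = x\<^sup>2 / 2 - (1 - x / 3) * (exp x - 1 - x)" for x :: real
  define g' where "g' x = x + (exp x - 1 - x) / 3 - (1 - x / 3) * (exp x - 1)" for x :: real
  have dg: "(g has_real_derivative g' x) (at x)" for x
    unfolding g_def g'_def by (auto intro!: derivative_eq_intros simp: field_simps)
  have dg': "(g' has_real_derivative (1 - exp x + x * exp x) / 3) (at x)" for x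
    unfolding g'_def by (auto intro!: derivative_eq_intros simp: field_simps)
  have "(1 - exp x + x * exp x) / 3 \<ge> 0" for x :: real
  proof -
    have "(1 - x) * exp x \<le> exp (- x) * exp x"
      using exp_ge_add_one_self[of "- x"] by (intro mult_right_mono) auto
    then show ?thesis by (simp add: algebra_simps flip: exp_add)
  qed
  then have "g' 0 \<le> g' x" if "x \<ge> 0" for x
    using that dg' by (intro DERIV_nonneg_imp_nondecreasing[of 0 x g']) blast+
  then have "g' x \<ge> 0" if "x \<ge> 0" for x using that by (simp add: g'_def)
  then have "g 0 \<le> g \<theta>"
    using assms dg by (intro DERIV_nonneg_imp_nondecreasing[of 0 \<theta> g]) blast+
  then show ?thesis by (simp add: g_def)
qed

locale independent_entries_eigenvalues = independent_entries \<pi> X D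
  for \<pi> :: "'s::finite \<Rightarrow> real" and X :: "'s \<Rightarrow> ((real, 'v::{finite,linorder}) vec, 'v) vec" and D :: real +
  fixes v :: "'s \<Rightarrow> (real, 'v) vec" and \<mu> :: "'s \<Rightarrow> real"
  assumes eigenvector: "\<And>k. norm (v k) = 1" "\<And>k. X k *v v k = \<mu> k *\<^sub>R v k"
begin

lemma even_moment_bound:
  assumes "even n"
  shows "(\<Sum>k\<in>UNIV. \<pi> k * \<mu> k ^ n) \<le> real CARD('v) * walk_bound D n 0 0"
proof -
  obtain m where n: "n = 2 * m" using assms by blast
  have "(\<Sum>k\<in>UNIV. \<pi> k * \<mu> k ^ n) \<le> (\<Sum>k\<in>UNIV. \<pi> k * (\<Sum>i\<in>UNIV. matrix_entry_pow (X k) n i i))"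
    unfolding n by (intro sum_mono mult_left_mono eigenvalue_power_le_trace[OF sym eigenvector] prob)
  also have "\<dots> = (\<Sum>i\<in>UNIV. \<Sum>k\<in>UNIV. \<pi> k * matrix_entry_pow (X k) n i i)"
    unfolding sum_distrib_left by (rule sum.swap)
  also have "\<dots> \<le> (\<Sum>i\<in>(UNIV::'v set). walk_bound D n 0 0)"
    by (intro sum_mono diagonal_moment_bound)
  finally show ?thesis by simp
qed

lemma cosh_moment_bound:
  assumes "\<theta> \<ge> 0"
  shows "(\<Sum>k\<in>UNIV. \<pi> k * cosh (\<theta> * \<mu> k)) \<le> real CARD('v) * exp (D * (exp \<theta> - 1 - \<theta>))"
proof -
  define c where "c n x = (if even n then x ^ n /\<^sub>R fact n else 0)" for n and x :: real
  have "(\<lambda>N. \<Sum>n<N. c n x) \<longlonglongrightarrow> cosh x" for x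
    using cosh_converges[of x] unfolding sums_def c_def .
  then have "(\<lambda>N. \<Sum>k\<in>UNIV. \<pi> k * (\<Sum>n<Suc N. c n (\<theta> * \<mu> k))) \<longlonglongrightarrow> (\<Sum>k\<in>UNIV. \<pi> k * cosh (\<theta> * \<mu> k))"
    by (intro tendsto_intros LIMSEQ_Suc[of "\<lambda>N. \<Sum>n<N. _ n"])
  moreover have "(\<Sum>k\<in>UNIV. \<pi> k * (\<Sum>n<Suc N. c n (\<theta> * \<mu> k))) \<le> real CARD('v) * exp (D * (exp \<theta> - 1 - \<theta>))" for N
  proof -
    have "(\<Sum>k\<in>UNIV. \<pi> k * (\<Sum>n<Suc N. c n (\<theta> * \<mu> k))) = (\<Sum>n<Suc N. \<Sum>k\<in>UNIV. \<pi> k * c n (\<theta> * \<mu> k))"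
      unfolding sum_distrib_left by (rule sum.swap)
    also have "\<dots> \<le> (\<Sum>n<Suc N. real CARD('v) * (\<theta> ^ n / fact n * walk_bound D n 0 0))"
    proof (intro sum_mono)
      fix n
      show "(\<Sum>k\<in>UNIV. \<pi> k * c n (\<theta> * \<mu> k)) \<le> real CARD('v) * (\<theta> ^ n / fact n * walk_bound D n 0 0)"
      proof (cases "even n")
        case True
        have "(\<Sum>k\<in>UNIV. \<pi> k * c n (\<theta> * \<mu> k)) = \<theta> ^ n / fact n * (\<Sum>k\<in>UNIV. \<pi> k * \<mu> k ^ n)"
          unfolding sum_distrib_left c_def using True
          by (intro sum.cong) (auto simp: power_mult_distrib field_simps)
        also have "\<dots> \<le> \<theta> ^ n / fact n * (real CARD('v) * walk_bound D n 0 0)"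
          using assms by (intro mult_left_mono even_moment_bound True) auto
        finally show ?thesis by (simp add: mult_ac)
      next
        case False
        then show ?thesis using assms walk_bound_nonneg[OF D_nonneg] by (simp add: c_def)
      qed
    qed
    also have "\<dots> = real CARD('v) * (\<Sum>n\<le>N. \<theta> ^ n / fact n * walk_bound D n 0 0)"
      unfolding sum_distrib_left lessThan_Suc_atMost ..
    also have "\<dots> \<le> real CARD('v) * exp (D * (exp \<theta> - 1 - \<theta>))"
      using walk_bound_generating_function[OF D_nonneg assms, where u = 0 and b = 0]
      by (intro mult_left_mono) auto
    finally show ?thesis .
  qed
  ultimately show ?thesis by (intro LIMSEQ_le_const2) auto
qed

lemma eigenvalue_tail_bound:
  assumes D: "D > 0" and s: "s \<ge> 0"
  shows "(\<Sum>k\<in>{k. \<mu> k > s}. \<pi> k) \<le> 2 * real CARD('v) * exp (- (3 * s\<^sup>2) / (2 * s + 6 * D))"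
proof -
  define \<theta> where "\<theta> = s / (D + s / 3)"
  have pos: "D + s / 3 > 0" using D s by simp
  have \<theta>: "\<theta> \<ge> 0" unfolding \<theta>_def using pos s by simp
  have one: "1 - \<theta> / 3 = D / (D + s / 3)" unfolding \<theta>_def using pos by (simp add: field_simps)
  have "D * (exp \<theta> - 1 - \<theta>) \<le> (D + s / 3) * (\<theta>\<^sup>2 / 2)"
    using exp_minus_linear_bernstein[OF \<theta>] unfolding one using pos by (simp add: field_simps)
  also have "\<dots> = \<theta> * s / 2" unfolding \<theta>_def using pos by (simp add: power2_eq_square)
  finally have expo: "D * (exp \<theta> - 1 - \<theta>) - \<theta> * s \<le> - (\<theta> * s / 2)" by simp
  have val: "- (\<theta> * s / 2) = - (3 * s\<^sup>2) / (2 * s + 6 * D)"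
    unfolding \<theta>_def using pos by (simp add: field_simps power2_eq_square)
  have "(\<Sum>k\<in>{k. \<mu> k > s}. \<pi> k) * (exp (\<theta> * s) / 2) = (\<Sum>k\<in>{k. \<mu> k > s}. \<pi> k * (exp (\<theta> * s) / 2))"
    by (simp add: sum_distrib_right)
  also have "\<dots> \<le> (\<Sum>k\<in>{k. \<mu> k > s}. \<pi> k * cosh (\<theta> * \<mu> k))"
  proof (intro sum_mono mult_left_mono prob)
    fix k assume "k \<in> {k. \<mu> k > s}"
    then have "exp (\<theta> * s) \<le> exp (\<theta> * \<mu> k)" using \<theta> by (auto intro!: mult_left_mono)
    then show "exp (\<theta> * s) / 2 \<le> cosh (\<theta> * \<mu> k)"
      unfolding cosh_def by (simp add: add_increasing2)
  qed
  also have "\<dots> \<le> (\<Sum>k\<in>UNIV. \<pi> k * cosh (\<theta> * \<mu> k))"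
    using prob by (intro sum_mono2) auto
  also have "\<dots> \<le> real CARD('v) * exp (D * (exp \<theta> - 1 - \<theta>))" by (rule cosh_moment_bound[OF \<theta>])
  finally have "(\<Sum>k\<in>{k. \<mu> k > s}. \<pi> k) \<le> 2 * real CARD('v) * (exp (D * (exp \<theta> - 1 - \<theta>)) / exp (\<theta> * s))"
    by (simp add: field_simps)
  also have "\<dots> = 2 * real CARD('v) * exp (D * (exp \<theta> - 1 - \<theta>) - \<theta> * s)" by (simp add: exp_diff)
  also have "\<dots> \<le> 2 * real CARD('v) * exp (- (\<theta> * s / 2))" using expo by (intro mult_left_mono) auto
  finally show ?thesis unfolding val .
qed

lemma eigenvalue_le_card: "\<mu> k \<le> real CARD('v)"
proof -
  have "(\<mu> k)\<^sup>2 \<le> (\<Sum>i\<in>UNIV. matrix_entry_pow (X k) (2 * 1) i i)"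
    using eigenvalue_power_le_trace[OF sym eigenvector, of k 1] by simp
  also have "\<dots> = (\<Sum>i\<in>UNIV. \<Sum>l\<in>UNIV. (X k $ i $ l)\<^sup>2)"
    using sym[of k] by (simp add: numeral_2_eq_2 power2_eq_square if_distrib[of "(*) _"] cong: if_cong)
  also have "\<dots> \<le> (\<Sum>i\<in>(UNIV::'v set). \<Sum>l\<in>(UNIV::'v set). 1)"
    using bounded by (intro sum_mono) (simp add: abs_square_le_1)
  also have "\<dots> = (real CARD('v))\<^sup>2" by (simp add: power2_eq_square)
  finally show ?thesis by (rule power2_le_imp_le) simp
qed

lemma expected_eigenvalue_bound:
  assumes D: "D > 0" and s: "s \<ge> 0"
  shows "(\<Sum>k\<in>UNIV. \<pi> k * \<mu> k) \<le> s + 2 * (real CARD('v))\<^sup>2 * exp (- (3 * s\<^sup>2) / (2 * s + 6 * D))"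
proof -
  have "(\<Sum>k\<in>UNIV. \<pi> k * \<mu> k) \<le> (\<Sum>k\<in>UNIV. s * \<pi> k + real CARD('v) * (if \<mu> k > s then \<pi> k else 0))"
  proof (intro sum_mono)
    fix k
    have "\<mu> k \<le> s + real CARD('v) * (if \<mu> k > s then 1 else 0)" using eigenvalue_le_card[of k] s by auto
    then have "\<pi> k * \<mu> k \<le> \<pi> k * (s + real CARD('v) * (if \<mu> k > s then 1 else 0))"
      by (intro mult_left_mono prob)
    then show "\<pi> k * \<mu> k \<le> s * \<pi> k + real CARD('v) * (if \<mu> k > s then \<pi> k else 0)"
      by (auto simp: algebra_simps split: if_splits)
  qed
  also have "\<dots> = s + real CARD('v) * (\<Sum>k\<in>{k. \<mu> k > s}. \<pi> k)"
    using prob(2) by (simp add: sum.distrib sum.If_cases flip: sum_distrib_left)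
  also have "\<dots> \<le> s + real CARD('v) * (2 * real CARD('v) * exp (- (3 * s\<^sup>2) / (2 * s + 6 * D)))"
    by (intro add_left_mono mult_left_mono eigenvalue_tail_bound assms) auto
  finally show ?thesis by (simp add: power2_eq_square mult_ac)
qed

end

section \<open>Finite Markov semigroups\<close>

lemma transition_functionD:
  assumes "transition_function Pt"
  shows "t \<ge> 0 \<Longrightarrow> Pt t i j \<ge> 0" "t \<ge> 0 \<Longrightarrow> (\<Sum>j\<in>UNIV. Pt t i j) = 1"
    "Pt 0 i j = (if i = j then 1 else 0)"
    "s \<ge> 0 \<Longrightarrow> t \<ge> 0 \<Longrightarrow> Pt (s + t) i j = (\<Sum>k\<in>UNIV. Pt s i k * Pt t k j)"
  using assms unfolding transition_function_def by blast+

lemma transition_step_le: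
  assumes tf: "transition_function Pt" and "s \<ge> 0" "t \<ge> 0"
  shows "Pt s i k * Pt t k j \<le> Pt (s + t) i j"
  unfolding transition_functionD(4)[OF tf assms(2,3)]
  using assms transition_functionD(1)[OF tf]
  by (intro member_le_sum[of k UNIV "\<lambda>k. Pt s i k * Pt t k j"]) auto

lemma transition_average_contract:
  fixes f :: "'s::finite \<Rightarrow> real"
  assumes tf: "transition_function Pt" and t: "t \<ge> 0"
    and e: "0 \<le> e" "e \<le> Pt t k j"
    and lo: "\<And>l. Pt t k l > 0 \<Longrightarrow> a \<le> f l" "a \<le> f j" and hi: "\<And>l. Pt t k l > 0 \<Longrightarrow> f l \<le> b" "f j \<le> b"
  shows "(1 - e) * a + e * f j \<le> (\<Sum>l\<in>UNIV. Pt t k l * f l)"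
    and "(\<Sum>l\<in>UNIV. Pt t k l * f l) \<le> (1 - e) * b + e * f j"
proof -
  note P = transition_functionD[OF tf]
  have nn: "0 \<le> Pt t k l * (f l - a)" "0 \<le> Pt t k l * (b - f l)" for l
    using P(1)[OF t, of k l] lo(1)[of l] hi(1)[of l] by (cases "Pt t k l = 0"; auto)+
  have "e * (f j - a) \<le> Pt t k j * (f j - a)"
    using e lo(2) by (intro mult_right_mono) auto
  also have "\<dots> \<le> (\<Sum>l\<in>UNIV. Pt t k l * (f l - a))"
    by (rule member_le_sum) (auto simp: nn)
  also have "\<dots> = (\<Sum>l\<in>UNIV. Pt t k l * f l) - a"
    using P(2)[OF t, of k] by (simp add: algebra_simps sum_subtractf flip: sum_distrib_left)
  finally show "(1 - e) * a + e * f j \<le> (\<Sum>l\<in>UNIV. Pt t k l * f l)"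
    by (simp add: algebra_simps)
  have "e * (b - f j) \<le> Pt t k j * (b - f j)"
    using e hi(2) by (intro mult_right_mono) auto
  also have "\<dots> \<le> (\<Sum>l\<in>UNIV. Pt t k l * (b - f l))"
    by (rule member_le_sum) (auto simp: nn)
  also have "\<dots> = b - (\<Sum>l\<in>UNIV. Pt t k l * f l)"
    using P(2)[OF t, of k] by (simp add: algebra_simps sum_subtractf flip: sum_distrib_left)
  finally show "(\<Sum>l\<in>UNIV. Pt t k l * f l) \<le> (1 - e) * b + e * f j"
    by (simp add: algebra_simps)
qed

lemma doeblin_convergence:
  fixes Pt :: "real \<Rightarrow> 's::finite \<Rightarrow> 's \<Rightarrow> real"
  assumes tf: "transition_function Pt" and "C \<noteq> {}"
    and closed: "\<And>t k j. t \<ge> 0 \<Longrightarrow> k \<in> C \<Longrightarrow> Pt t k j > 0 \<Longrightarrow> j \<in> C"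
    and T: "T > 0" and reach: "\<And>k. k \<in> C \<Longrightarrow> Pt T k j0 > 0"
  obtains \<mu> r where "stationary_distribution Pt \<mu>" "\<And>j. j \<notin> C \<Longrightarrow> \<mu> j = 0" "0 \<le> r" "r < 1"
    "\<And>k j m t. k \<in> C \<Longrightarrow> t \<ge> real m * T \<Longrightarrow> \<bar>Pt t k j - \<mu> j\<bar> \<le> r ^ m"
proof -
  note P = transition_functionD[OF tf]
  obtain k0 where k0: "k0 \<in> C" using \<open>C \<noteq> {}\<close> by blast
  have j0: "j0 \<in> C" using closed[OF _ k0 reach[OF k0]] T by simp
  define e where "e = Min ((\<lambda>k. Pt T k j0) ` C)"
  have e_pos: "e > 0" unfolding e_def using reach k0 by (subst Min_gr_iff) auto
  have e_le: "e \<le> Pt T k j0" if "k \<in> C" for k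
    unfolding e_def using that by (intro Min_le) auto
  have Pt_le1: "Pt t k j \<le> 1" if "t \<ge> 0" for t k j
    using member_le_sum[of j UNIV "Pt t k"] P(1,2)[OF that] by auto
  define lo hi where "lo t j = Min ((\<lambda>k. Pt t k j) ` C)" and "hi t j = Max ((\<lambda>k. Pt t k j) ` C)" for t j
  have lohi: "lo t j \<le> Pt t k j" "Pt t k j \<le> hi t j" if "k \<in> C" for t k j
    unfolding lo_def hi_def using that by auto
  have loI: "a \<le> lo t j" if "\<And>k. k \<in> C \<Longrightarrow> a \<le> Pt t k j" for a t j
    unfolding lo_def using that k0 by (subst Min_ge_iff) auto
  have hiI: "hi t j \<le> a" if "\<And>k. k \<in> C \<Longrightarrow> Pt t k j \<le> a" for a t j
    unfolding hi_def using that k0 by (subst Max_le_iff) auto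
  have lo_mono: "lo t j \<le> lo (s + t) j" and hi_mono: "hi (s + t) j \<le> hi t j" if "s \<ge> 0" "t \<ge> 0" for s t j
  proof -
    have "lo t j \<le> Pt (s + t) k j \<and> Pt (s + t) k j \<le> hi t j" if "k \<in> C" for k
      using transition_average_contract[OF tf \<open>s \<ge> 0\<close>, of 0 k j0 "lo t j" "\<lambda>l. Pt t l j" "hi t j"]
        lohi closed[OF \<open>s \<ge> 0\<close> that] j0 P(1)[OF \<open>s \<ge> 0\<close>] P(4)[OF \<open>s \<ge> 0\<close> \<open>t \<ge> 0\<close>] by auto
    then show "lo t j \<le> lo (s + t) j" "hi (s + t) j \<le> hi t j" by (auto intro: loI hiI)
  qed
  have step: "hi (T + t) j - lo (T + t) j \<le> (1 - e) * (hi t j - lo t j)" if "t \<ge> 0" for t j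
  proof -
    have T0: "T \<ge> 0" using T by simp
    have *: "(1 - e) * lo t j + e * Pt t j0 j \<le> Pt (T + t) k j \<and> Pt (T + t) k j \<le> (1 - e) * hi t j + e * Pt t j0 j"
      if "k \<in> C" for k
      using transition_average_contract[OF tf T0, of e k j0 "lo t j" "\<lambda>l. Pt t l j" "hi t j"]
        lohi closed[OF T0 that] j0 e_pos e_le[OF that] P(4)[OF T0 \<open>t \<ge> 0\<close>] by auto
    have "(1 - e) * lo t j + e * Pt t j0 j \<le> lo (T + t) j" "hi (T + t) j \<le> (1 - e) * hi t j + e * Pt t j0 j"
      using * by (auto intro: loI hiI)
    then show ?thesis by (simp add: algebra_simps)
  qed
  define r where "r = 1 - e"
  have r: "0 \<le> r" "r < 1"
    using e_pos e_le[OF k0] Pt_le1[of T k0 j0] T by (auto simp: r_def)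
  have osc: "hi t j - lo t j \<le> r ^ m" if "t \<ge> real m * T" for t m j
    using that
  proof (induction m arbitrary: t)
    case 0
    then show ?case using lohi[OF k0, of t j] P(1)[of t _ j] Pt_le1[of t _ j]
      using loI[of 0 t j] hiI[of t j 1] by fastforce
  next
    case (Suc m)
    have "real m * T \<ge> 0" using T by simp
    then have tT: "t - T \<ge> 0" using Suc.prems by (simp add: algebra_simps)
    have "hi t j - lo t j \<le> r * (hi (t - T) j - lo (t - T) j)"
      using step[of "t - T" j] tT unfolding r_def by simp
    also have "\<dots> \<le> r * r ^ m"
      using Suc.prems r by (intro mult_left_mono Suc.IH) (auto simp: algebra_simps)
    finally show ?case by simp
  qed
  define \<mu> where "\<mu> j = (SUP t\<in>{0..}. lo t j)" for j
  have cross: "lo s j \<le> hi t j" if "s \<ge> 0" "t \<ge> 0" for s t j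
    using lo_mono[OF that(2,1), of j] hi_mono[OF that, of j] lohi[OF k0, of "s + t" j]
    by (simp add: add.commute)
  have mu: "lo t j \<le> \<mu> j" "\<mu> j \<le> hi t j" if "t \<ge> 0" for t j
  proof -
    have "bdd_above ((\<lambda>t. lo t j) ` {0..})" using cross[OF _ that] by (intro bdd_aboveI2) auto
    then show "lo t j \<le> \<mu> j" unfolding \<mu>_def using that by (intro cSUP_upper) auto
    show "\<mu> j \<le> hi t j" unfolding \<mu>_def using cross[OF _ that] by (intro cSUP_least) auto
  qed
  have dist: "\<bar>Pt t k j - \<mu> j\<bar> \<le> r ^ m" if "k \<in> C" "t \<ge> real m * T" for k j m t
  proof -
    have "t \<ge> 0" using that(2) T by (smt (verit) mult_nonneg_nonneg of_nat_0_le_iff)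
    then show ?thesis using mu[of t j] lohi[OF that(1), of t j] osc[OF that(2), of j] by linarith
  qed
  have lim: "(\<lambda>m. Pt (real m * T + s) k j) \<longlonglongrightarrow> \<mu> j" if "k \<in> C" "s \<ge> 0" for k j s
  proof -
    have "(\<lambda>m. r ^ m) \<longlonglongrightarrow> 0" using r by (intro LIMSEQ_realpow_zero) auto
    then have "(\<lambda>m. Pt (real m * T + s) k j - \<mu> j) \<longlonglongrightarrow> 0"
      by (rule Lim_null_comparison[rotated]) (use dist[OF that(1)] that(2) in auto)
    then show ?thesis by (simp add: LIM_zero_iff)
  qed
  have mT: "real m * T + s \<ge> 0" if "s \<ge> 0" for m s using T that by simp
  have "stationary_distribution Pt \<mu>"
    unfolding stationary_distribution_def
  proof (intro conjI allI impI)
    show "\<mu> k \<ge> 0" for k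
      using lim[OF k0, of 0 k] P(1) T by (intro LIMSEQ_le_const) auto
    have "(\<lambda>m. \<Sum>k\<in>UNIV. Pt (real m * T + 0) k0 k) \<longlonglongrightarrow> (\<Sum>k\<in>UNIV. \<mu> k)"
      by (intro tendsto_sum lim k0) auto
    then show "(\<Sum>k\<in>UNIV. \<mu> k) = 1"
      using P(2) mT[of 0] by (simp add: LIMSEQ_const_iff)
    show "(\<Sum>i\<in>UNIV. \<mu> i * Pt s i j) = \<mu> j" if "s \<ge> 0" for s j
    proof (rule LIMSEQ_unique)
      show "(\<lambda>m. Pt (real m * T + s) k0 j) \<longlonglongrightarrow> \<mu> j" by (rule lim[OF k0 that])
      have "(\<lambda>m. \<Sum>i\<in>UNIV. Pt (real m * T + 0) k0 i * Pt s i j) \<longlonglongrightarrow> (\<Sum>i\<in>UNIV. \<mu> i * Pt s i j)"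
        by (intro tendsto_intros lim k0) auto
      then show "(\<lambda>m. Pt (real m * T + s) k0 j) \<longlonglongrightarrow> (\<Sum>i\<in>UNIV. \<mu> i * Pt s i j)"
        using P(4)[OF _ that] mT[of 0] by simp
    qed
  qed
  moreover have "\<mu> j = 0" if "j \<notin> C" for j
  proof -
    have "Pt (real m * T + 0) k0 j = 0" for m
      using closed[OF mT[of 0 m] k0, of j] that P(1)[OF mT[of 0 m], of k0 j] by force
    then show ?thesis using lim[OF k0, of 0 j] by (simp add: LIMSEQ_const_iff)
  qed
  ultimately show thesis using that[of \<mu> r] r dist by blast
qed

text \<open>Every state reaches a minimal closed class, and such a class carries a stationary
  distribution; uniqueness forces all of these classes to contain the support of \<open>\<pi>\<close>.\<close>

lemma unique_stationary_convergence:
  fixes Pt :: "real \<Rightarrow> 's::finite \<Rightarrow> 's \<Rightarrow> real"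
  assumes tf: "transition_function Pt"
    and stat: "stationary_distribution Pt \<pi>"
    and unique: "\<forall>\<pi>'. stationary_distribution Pt \<pi>' \<longrightarrow> \<pi>' = \<pi>"
    and "R \<noteq> {}" and closed: "\<And>t k j. t \<ge> 0 \<Longrightarrow> k \<in> R \<Longrightarrow> Pt t k j > 0 \<Longrightarrow> j \<in> R"
    and diag: "\<And>t k. t \<ge> 0 \<Longrightarrow> k \<in> R \<Longrightarrow> Pt t k k > 0"
  obtains T r where "T > 0" "0 \<le> r" "r < 1"
    "\<And>k j m t. k \<in> R \<Longrightarrow> t \<ge> real m * T \<Longrightarrow> \<bar>Pt t k j - \<pi> j\<bar> \<le> r ^ m"
proof -
  note P = transition_functionD[OF tf]
  define C where "C k = {j. \<exists>t\<ge>0. Pt t k j > 0}" for k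
  have self: "k \<in> C k" for k unfolding C_def using P(3)[of k k] by (auto intro!: exI[of _ 0])
  have C_closed: "j \<in> C k" if lk: "l \<in> C k" and "Pt t l j > 0" "t \<ge> 0" for j k l t
  proof -
    obtain s where s: "s \<ge> 0" "Pt s k l > 0" using lk unfolding C_def by blast
    have "Pt (s + t) k j > 0"
      using transition_step_le[OF tf s(1) that(3), of k l j] mult_pos_pos[OF s(2) that(2)] by linarith
    then show ?thesis unfolding C_def using s(1) that(3) by (auto intro!: exI[of _ "s + t"])
  qed
  have C_trans: "C l \<subseteq> C k" if "l \<in> C k" for k l
    using C_closed[OF that] unfolding C_def[of l] by blast
  have C_R: "C k \<subseteq> R" if "k \<in> R" for k
    using closed that unfolding C_def by blast
  have common: "\<exists>T>0. \<forall>k\<in>D. Pt T k j > 0" if D: "D \<subseteq> R" "\<And>k. k \<in> D \<Longrightarrow> j \<in> C k" for D j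
  proof -
    have "\<exists>t\<ge>0. Pt t k j > 0" if "k \<in> D" for k using D(2)[OF that] unfolding C_def by blast
    then obtain \<tau> where \<tau>: "\<And>k. k \<in> D \<Longrightarrow> \<tau> k \<ge> 0 \<and> Pt (\<tau> k) k j > 0" by metis
    define T where "T = (\<Sum>k\<in>D. \<tau> k) + 1"
    have "Pt T k j > 0" if "k \<in> D" for k
    proof -
      have "\<tau> k \<le> (\<Sum>k\<in>D. \<tau> k)" using that \<tau> by (intro member_le_sum) auto
      then have "T - \<tau> k \<ge> 0" unfolding T_def by simp
      moreover have "j \<in> R" using closed[of "\<tau> k" k j] \<tau>[OF that] that D by auto
      ultimately show ?thesis
        using transition_step_le[OF tf, of "\<tau> k" "T - \<tau> k" k j j] \<tau>[OF that] diag[of "T - \<tau> k" j]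
        by (smt (verit) mult_pos_pos)
    qed
    moreover have "T > 0" unfolding T_def using \<tau> by (smt (verit) sum_nonneg)
    ultimately show ?thesis by blast
  qed
  have supp: "j \<in> C k" if k: "k \<in> R" and "\<pi> j > 0" for k j
  proof -
    obtain l where l: "l \<in> C k" and min: "\<And>i. i \<in> C k \<Longrightarrow> card (C l) \<le> card (C i)"
      using arg_min_if_finite[of "C k" "\<lambda>i. card (C i)"] self[of k]
      by (metis (no_types, lifting) empty_iff finite_code linorder_not_less)
    have eq: "C i = C l" if "i \<in> C l" for i
      using C_trans[OF that] min[of i] C_trans[OF l] that by (metis card_subset_eq finite_code in_mono card_mono le_antisym)
    have lR: "C l \<subseteq> R" using C_trans[OF l] C_R[OF k] by blast
    obtain T where T: "T > 0" "\<forall>i\<in>C l. Pt T i l > 0"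
      using common[OF lR, of l] eq self[of l] by blast
    obtain \<mu> where \<mu>: "stationary_distribution Pt \<mu>" "\<And>j. j \<notin> C l \<Longrightarrow> \<mu> j = 0"
      using doeblin_convergence[OF tf, of "C l" T l] self[of l] C_closed T by (metis empty_iff)
    have "\<mu> = \<pi>" using unique \<mu>(1) by blast
    then have "j \<in> C l" using \<mu>(2)[of j] that(2) by fastforce
    then show ?thesis using C_trans[OF l] by blast
  qed
  obtain j where j: "\<pi> j > 0"
    using stat unfolding stationary_distribution_def
    by (metis (mono_tags, opaque_lifting) not_less order_antisym sum.neutral zero_neq_one)
  obtain T where T: "T > 0" "\<forall>k\<in>R. Pt T k j > 0" using common[of R j] supp[OF _ j] by blast
  obtain \<mu> r where \<mu>: "stationary_distribution Pt \<mu>" "0 \<le> r" "r < 1"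
    "\<And>k j m t. k \<in> R \<Longrightarrow> t \<ge> real m * T \<Longrightarrow> \<bar>Pt t k j - \<mu> j\<bar> \<le> r ^ m"
    by (rule doeblin_convergence[OF tf \<open>R \<noteq> {}\<close> _ T(1), of j]) (use closed T(2) in blast)+
  have "\<mu> = \<pi>" using unique \<mu>(1) by blast
  then show thesis using that[OF T(1) \<mu>(2,3)] \<mu>(4) by simp
qed

section \<open>Ergodic averages of the switching process\<close>

text \<open>Grid points approach every time from the right, so Riemann sums converge although the
  jumps of \<open>y\<close> may accumulate from the left.\<close>

lemma right_constant_riemann_sums:
  fixes y :: "real \<Rightarrow> real"
  assumes bounded: "\<And>s. \<bar>y s\<bar> \<le> B"
    and rc: "\<And>t. t \<ge> 0 \<Longrightarrow> \<exists>e>0. \<forall>s. t \<le> s \<and> s < t + e \<longrightarrow> y s = y t"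
    and c: "c \<ge> 0" and d: "d > 0"
  shows "y integrable_on {c..c + d}"
    and "(\<lambda>n. (\<Sum>a<Suc n. y (c + d * real (Suc a) / real (Suc n))) / real (Suc n)) \<longlonglongrightarrow> integral {c..c + d} y / d"
proof -
  define z where "z n s = c + d * real_of_int \<lceil>(s - c) * real (Suc n) / d\<rceil> / real (Suc n)" for n s
  have step: "((\<lambda>s. y (z n s)) has_integral (\<Sum>a<m. d / real (Suc n) * y (c + d * real (Suc a) / real (Suc n))))
      {c..c + d * real m / real (Suc n)}" for n m
  proof (induction m)
    case 0
    show ?case using has_integral_refl(2)[of "\<lambda>s. y (z n s)" c] by simp
  next
    case (Suc m)
    let ?l = "c + d * real m / real (Suc n)" and ?u = "c + d * real (Suc m) / real (Suc n)"
    have diff: "?u - ?l = d / real (Suc n)"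
      by (simp add: distrib_left add_divide_distrib del: of_nat_Suc add: of_nat_Suc[of m])
    have "d / real (Suc n) \<ge> 0" using d by simp
    then have lu: "?l \<le> ?u" using diff by linarith
    have "((\<lambda>s. y ?u) has_integral (?u - ?l) *\<^sub>R y ?u) {?l..?u}"
      using has_integral_const_real[of "y ?u" ?l ?u] lu by (simp del: of_nat_Suc)
    then have "((\<lambda>s. y (z n s)) has_integral (?u - ?l) *\<^sub>R y ?u) {?l..?u}"
    proof (rule has_integral_spike_finite[rotated 2])
      show "finite {?l}" by simp
      fix s assume s: "s \<in> {?l..?u} - {?l}"
      then have "d * real m / real (Suc n) < s - c" "s - c \<le> d * real (Suc m) / real (Suc n)" by auto
      then have "real m < (s - c) * real (Suc n) / d" "(s - c) * real (Suc n) / d \<le> real (Suc m)"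
        using d by (simp_all add: field_simps del: of_nat_Suc)
      then have "\<lceil>(s - c) * real (Suc n) / d\<rceil> = int (Suc m)" by (intro ceiling_unique) auto
      then show "y (z n s) = y ?u" unfolding z_def by simp
    qed
    with Suc have "((\<lambda>s. y (z n s)) has_integral
        (\<Sum>a<m. d / real (Suc n) * y (c + d * real (Suc a) / real (Suc n))) + (?u - ?l) *\<^sub>R y ?u) {c..?u}"
      using d lu by (intro has_integral_combine[of c ?l ?u]) auto
    then show ?case unfolding diff by (simp del: of_nat_Suc)
  qed
  have st: "((\<lambda>s. y (z n s)) has_integral (\<Sum>a<Suc n. d / real (Suc n) * y (c + d * real (Suc a) / real (Suc n)))) {c..c + d}" for n
    using step[of n "Suc n"] by simp
  have lim: "(\<lambda>n. y (z n s)) \<longlonglongrightarrow> y s" if "s \<in> {c..c + d}" for s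
  proof -
    obtain e where e: "e > 0" "\<And>u. s \<le> u \<Longrightarrow> u < s + e \<Longrightarrow> y u = y s"
      using rc[of s] \<open>s \<in> _\<close> c by auto
    have "(\<lambda>n. d * inverse (real (Suc n))) \<longlonglongrightarrow> d * 0"
      by (intro tendsto_intros LIMSEQ_inverse_real_of_nat)
    then have "\<forall>\<^sub>F n in sequentially. d * inverse (real (Suc n)) < e"
      using e(1) by (intro order_tendstoD(2)[of _ "d * 0"]) auto
    then have "\<forall>\<^sub>F n in sequentially. y (z n s) = y s"
    proof (rule eventually_mono)
      fix n assume small: "d * inverse (real (Suc n)) < e"
      define q where "q = (s - c) * real (Suc n) / d"
      have sq: "s = c + d * q / real (Suc n)" unfolding q_def using d by simp
      have "q \<le> real_of_int \<lceil>q\<rceil>" "real_of_int \<lceil>q\<rceil> < q + 1" by linarith+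
      then have "d * q / real (Suc n) \<le> d * real_of_int \<lceil>q\<rceil> / real (Suc n)"
        "d * real_of_int \<lceil>q\<rceil> / real (Suc n) < d * (q + 1) / real (Suc n)"
        using d by (auto intro!: divide_right_mono divide_strict_right_mono mult_left_mono mult_strict_left_mono
            simp del: of_nat_Suc)
      moreover have "d * (q + 1) / real (Suc n) = d * q / real (Suc n) + d * inverse (real (Suc n))"
        by (simp add: field_simps del: of_nat_Suc)
      ultimately have "s \<le> z n s" "z n s < s + e"
        unfolding z_def q_def[symmetric] using sq small by linarith+
      then show "y (z n s) = y s" by (rule e(2))
    qed
    then show ?thesis by (rule tendsto_eventually)
  qed
  have dc: "y integrable_on {c..c + d}" "(\<lambda>n. integral {c..c + d} (\<lambda>s. y (z n s))) \<longlonglongrightarrow> integral {c..c + d} y"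
    by (rule dominated_convergence[where h = "\<lambda>_. B" and f = "\<lambda>n s. y (z n s)"]; use st lim bounded in auto)+
  show "y integrable_on {c..c + d}" by (rule dc(1))
  have "(\<lambda>n. integral {c..c + d} (\<lambda>s. y (z n s)) / d) \<longlonglongrightarrow> integral {c..c + d} y / d"
    using dc d by (intro tendsto_intros) auto
  moreover have "integral {c..c + d} (\<lambda>s. y (z n s)) / d
      = (\<Sum>a<Suc n. y (c + d * real (Suc a) / real (Suc n))) / real (Suc n)" for n
    unfolding integral_unique[OF st] sum_distrib_left[symmetric]
    using d by (simp del: of_nat_Suc sum.lessThan_Suc)
  ultimately show "(\<lambda>n. (\<Sum>a<Suc n. y (c + d * real (Suc a) / real (Suc n))) / real (Suc n)) \<longlonglongrightarrow> integral {c..c + d} y / d"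
    by (simp del: of_nat_Suc sum.lessThan_Suc)
qed

context prob_space
begin

lemma AE_tendsto_zero_of_summable_expectation:
  fixes f :: "nat \<Rightarrow> 'a \<Rightarrow> real"
  assumes int: "\<And>j. integrable M (f j)" and nn: "\<And>j \<omega>. f j \<omega> \<ge> 0"
    and sm: "summable (\<lambda>j. expectation (f j))"
  shows "AE \<omega> in M. (\<lambda>j. f j \<omega>) \<longlonglongrightarrow> 0"
proof -
  have meas: "f j \<in> borel_measurable M" for j using int by auto
  have "(\<integral>\<^sup>+\<omega>. (\<Sum>j. ennreal (f j \<omega>)) \<partial>M) = (\<Sum>j. \<integral>\<^sup>+\<omega>. ennreal (f j \<omega>) \<partial>M)"
    using meas by (intro nn_integral_suminf) auto
  also have "\<dots> = (\<Sum>j. ennreal (expectation (f j)))"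
    using int nn by (intro suminf_cong nn_integral_eq_integral) auto
  also have "\<dots> \<noteq> \<infinity>"
    using sm nn by (simp add: suminf_ennreal2)
  finally have "AE \<omega> in M. (\<Sum>j. ennreal (f j \<omega>)) \<noteq> \<infinity>"
    using meas by (intro nn_integral_PInf_AE) auto
  then show ?thesis
  proof (rule AE_mp, intro AE_I2 impI)
    fix \<omega> assume "(\<Sum>j. ennreal (f j \<omega>)) \<noteq> \<infinity>"
    then have "summable (\<lambda>j. f j \<omega>)" using nn by (intro summable_suminf_not_top) auto
    then show "(\<lambda>j. f j \<omega>) \<longlonglongrightarrow> 0" by (rule summable_LIMSEQ_zero)
  qed
qed

lemma bounded_decorrelated_averages:
  fixes Z :: "nat \<Rightarrow> 'a \<Rightarrow> real"
  assumes meas[measurable]: "\<And>m. Z m \<in> borel_measurable M"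
    and bnd: "\<And>m \<omega>. \<omega> \<in> space M \<Longrightarrow> \<bar>Z m \<omega>\<bar> \<le> B"
    and corr: "\<And>m l. m < l \<Longrightarrow> \<bar>expectation (\<lambda>\<omega>. Z m \<omega> * Z l \<omega>)\<bar> \<le> C * r ^ (l - Suc m)"
    and r: "0 \<le> r" "r < 1"
  shows "AE \<omega> in M. (\<lambda>j. (\<Sum>m<(Suc j)\<^sup>2. Z m \<omega>) / real ((Suc j)\<^sup>2)) \<longlonglongrightarrow> 0"
proof -
  have C: "C \<ge> 0" using corr[of 0 1] by simp
  define S where "S N \<omega> = (\<Sum>m<N. Z m \<omega>)" for N \<omega>
  have [measurable]: "S N \<in> borel_measurable M" for N unfolding S_def by measurable
  have S_bnd: "\<bar>S N \<omega>\<bar> \<le> real N * B" if "\<omega> \<in> space M" for N \<omega>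
    unfolding S_def using sum_bounded_above[of "{..<N}" "\<lambda>m. \<bar>Z m \<omega>\<bar>" B] bnd[OF that]
    by (intro order_trans[OF sum_abs]) auto
  have int_S: "integrable M (\<lambda>\<omega>. (S N \<omega>)\<^sup>2)" for N
  proof (rule integrable_const_bound[where B = "(real N * B)\<^sup>2"])
    show "AE \<omega> in M. norm ((S N \<omega>)\<^sup>2) \<le> (real N * B)\<^sup>2"
      using power_mono[OF S_bnd abs_ge_zero, of _ N 2] by (intro AE_I2) simp
  qed simp
  have int_Z: "integrable M (\<lambda>\<omega>. Z m \<omega> * Z l \<omega>)" for m l
  proof (rule integrable_const_bound[where B = "B * B"])
    show "AE \<omega> in M. norm (Z m \<omega> * Z l \<omega>) \<le> B * B"
      using bnd by (intro AE_I2) (auto simp: abs_mult intro!: mult_mono order_trans[OF abs_ge_zero])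
  qed simp
  define K where "K = B * B + 2 * (C / (1 - r))"
  have var: "expectation (\<lambda>\<omega>. (S N \<omega>)\<^sup>2) \<le> real N * K" for N
  proof (induction N)
    case 0
    show ?case by (simp add: S_def)
  next
    case (Suc N)
    have expand: "(S (Suc N) \<omega>)\<^sup>2 = (S N \<omega>)\<^sup>2 + (2 * (\<Sum>m<N. Z m \<omega> * Z N \<omega>) + Z N \<omega> * Z N \<omega>)" for \<omega>
      unfolding S_def by (simp add: power2_eq_square algebra_simps sum_distrib_left)
    have "expectation (\<lambda>\<omega>. (S (Suc N) \<omega>)\<^sup>2) = expectation (\<lambda>\<omega>. (S N \<omega>)\<^sup>2)
        + (2 * (\<Sum>m<N. expectation (\<lambda>\<omega>. Z m \<omega> * Z N \<omega>)) + expectation (\<lambda>\<omega>. Z N \<omega> * Z N \<omega>))"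
      unfolding expand using int_S int_Z by simp
    moreover have "(\<Sum>m<N. expectation (\<lambda>\<omega>. Z m \<omega> * Z N \<omega>)) \<le> (\<Sum>m<N. C * r ^ (N - Suc m))"
      using corr by (intro sum_mono) (auto intro: order_trans[OF abs_ge_self])
    moreover have "(\<Sum>m<N. C * r ^ (N - Suc m)) = C * (\<Sum>m<N. r ^ m)"
      using sum.nat_diff_reindex[of "\<lambda>m. r ^ m" N] by (simp flip: sum_distrib_left)
    moreover have "C * (\<Sum>m<N. r ^ m) \<le> C * (1 / (1 - r))"
    proof (intro mult_left_mono C)
      have "(\<Sum>m<N. r ^ m) \<le> (\<Sum>m. r ^ m)"
        using r by (intro sum_le_suminf summable_geometric) auto
      then show "(\<Sum>m<N. r ^ m) \<le> 1 / (1 - r)" using r suminf_geometric[of r] by simp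
    qed
    moreover have "expectation (\<lambda>\<omega>. Z N \<omega> * Z N \<omega>) \<le> B * B"
    proof (rule integral_le_const[OF int_Z])
      show "AE \<omega> in M. Z N \<omega> * Z N \<omega> \<le> B * B"
        using bnd by (intro AE_I2) (metis abs_mult_self_eq abs_ge_zero mult_mono' )
    qed
    ultimately have "expectation (\<lambda>\<omega>. (S (Suc N) \<omega>)\<^sup>2) \<le> real N * K + (2 * (C * (1 / (1 - r))) + B * B)"
      using Suc by linarith
    also have "\<dots> = real (Suc N) * K" by (simp add: K_def distrib_right)
    finally show ?case .
  qed
  define f where "f j \<omega> = (S ((Suc j)\<^sup>2) \<omega> / real ((Suc j)\<^sup>2))\<^sup>2" for j \<omega>
  have f_nonneg: "f j \<omega> \<ge> 0" for j \<omega> unfolding f_def by simp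
  have int_f: "integrable M (f j)" for j
    unfolding f_def power_divide using int_S by simp
  have Ef: "expectation (f j) \<le> K * inverse (real (Suc j) ^ 2)" for j
  proof -
    define w where "w = real ((Suc j)\<^sup>2)"
    have w: "w > 0" unfolding w_def by simp
    have "expectation (f j) = expectation (\<lambda>\<omega>. (S ((Suc j)\<^sup>2) \<omega>)\<^sup>2) / w\<^sup>2"
      unfolding f_def power_divide w_def[symmetric] by simp
    also have "\<dots> \<le> (w * K) / w\<^sup>2"
      unfolding w_def by (intro divide_right_mono var) simp
    also have "\<dots> = K * inverse w" using w by (simp add: power2_eq_square field_simps)
    finally show ?thesis unfolding w_def by simp
  qed
  have "summable (\<lambda>j. K * inverse (real (Suc j) ^ 2))"
    using inverse_power_summable[of 2, where 'a = real] by (intro summable_mult) (subst summable_Suc_iff, simp)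
  then have "summable (\<lambda>j. expectation (f j))"
    by (rule summable_comparison_test'[where N = 0]) (use Ef in \<open>auto simp: f_def\<close>)
  then have "AE \<omega> in M. (\<lambda>j. f j \<omega>) \<longlonglongrightarrow> 0"
    using AE_tendsto_zero_of_summable_expectation[of f, OF int_f f_nonneg] by blast
  then show ?thesis
    unfolding f_def S_def by (simp add: power_tendsto_0_iff del: power_divide)
qed

end

locale ergodic_markov =
  fixes M :: "'w measure" and Pt :: "real \<Rightarrow> 's::finite \<Rightarrow> 's \<Rightarrow> real" and \<sigma> :: "'w \<Rightarrow> real \<Rightarrow> 's"
    and \<sigma>0 :: 's and \<pi> :: "'s \<Rightarrow> real"
  assumes markov: "markov_process M Pt \<sigma>"
    and init: "\<forall>\<omega>\<in>space M. \<sigma> \<omega> 0 = \<sigma>0"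
    and stat: "stationary_distribution Pt \<pi>"
    and unique: "\<forall>\<pi>'. stationary_distribution Pt \<pi>' \<longrightarrow> \<pi>' = \<pi>"

sublocale ergodic_markov \<subseteq> prob_space M
  using markov unfolding markov_process_def by blast

context ergodic_markov
begin

lemma tf: "transition_function Pt"
  using markov unfolding markov_process_def by blast

lemma \<sigma>_measurable[measurable]: "(\<lambda>\<omega>. \<sigma> \<omega> t) \<in> measurable M (count_space UNIV)"
  using markov unfolding markov_process_def by blast

lemma right_constant:
  "\<omega> \<in> space M \<Longrightarrow> t \<ge> 0 \<Longrightarrow> \<exists>e>0. \<forall>s. t \<le> s \<and> s < t + e \<longrightarrow> \<sigma> \<omega> s = \<sigma> \<omega> t"
  using markov unfolding markov_process_def by blast

lemma two_time_law:
  assumes "0 \<le> s" "s < t"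
  shows "prob {\<omega>\<in>space M. \<sigma> \<omega> s = k \<and> \<sigma> \<omega> t = j} = prob {\<omega>\<in>space M. \<sigma> \<omega> s = k} * Pt (t - s) k j"
proof -
  have "length [s] = length [k] \<and> [s] \<noteq> [] \<and> sorted_wrt (<) [s] \<and> 0 \<le> hd [s] \<and> last [s] < t"
    using assms by simp
  then have "prob {\<omega>\<in>space M. (\<forall>i<length [s]. \<sigma> \<omega> ([s] ! i) = [k] ! i) \<and> \<sigma> \<omega> t = j}
    = prob {\<omega>\<in>space M. \<forall>i<length [s]. \<sigma> \<omega> ([s] ! i) = [k] ! i} * Pt (t - last [s]) (last [k]) j"
    using markov unfolding markov_process_def by blast
  then show ?thesis by simp
qed

lemma law:
  assumes "t \<ge> 0"
  shows "prob {\<omega>\<in>space M. \<sigma> \<omega> t = k} = Pt t \<sigma>0 k"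
proof (cases "t = 0")
  case True
  have "{\<omega>\<in>space M. \<sigma> \<omega> 0 = k} = (if \<sigma>0 = k then space M else {})" using init by auto
  then show ?thesis using True transition_functionD(3)[OF tf, of \<sigma>0 k] prob_space by simp
next
  case False
  have "{\<omega>\<in>space M. \<sigma> \<omega> 0 = \<sigma>0} = space M" "{\<omega>\<in>space M. \<sigma> \<omega> 0 = \<sigma>0 \<and> \<sigma> \<omega> t = k} = {\<omega>\<in>space M. \<sigma> \<omega> t = k}"
    using init by auto
  then show ?thesis using two_time_law[of 0 t \<sigma>0 k] False assms prob_space by simp
qed

definition reachable :: "'s set" where
  "reachable = {k. \<exists>t\<ge>0. Pt t \<sigma>0 k > 0}"

lemma reachable_closed:
  assumes "t \<ge> 0" "k \<in> reachable" "Pt t k j > 0"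
  shows "j \<in> reachable"
proof -
  obtain s where s: "s \<ge> 0" "Pt s \<sigma>0 k > 0" using assms(2) unfolding reachable_def by blast
  have "Pt (s + t) \<sigma>0 j > 0"
    using transition_step_le[OF tf s(1) assms(1), of \<sigma>0 k j] mult_pos_pos[OF s(2) assms(3)] by linarith
  then show ?thesis unfolding reachable_def using s(1) assms(1) by (auto intro!: exI[of _ "s + t"])
qed

text \<open>Right continuity of the paths makes the transition function right continuous at \<open>0\<close>, but
  only at reachable states.\<close>

lemma reachable_diag_pos:
  assumes t: "t \<ge> 0" and k: "k \<in> reachable"
  shows "Pt t k k > 0"
proof (cases "t = 0")
  case True
  then show ?thesis using transition_functionD(3)[OF tf, of k k] by simp
next
  case False
  then have "t > 0" using t by simp
  obtain s where s: "s \<ge> 0" "Pt s \<sigma>0 k > 0" using k unfolding reachable_def by blast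
  define A where "A = {\<omega>\<in>space M. \<sigma> \<omega> s = k}"
  define A' where "A' n = {\<omega>\<in>space M. \<sigma> \<omega> s = k \<and> \<sigma> \<omega> (s + t / real (Suc n)) = k}" for n
  have meas: "A \<in> sets M" "A' n \<in> sets M" for n unfolding A_def A'_def by measurable
  have "(\<lambda>n. expectation (indicator (A' n) :: 'w \<Rightarrow> real)) \<longlonglongrightarrow> expectation (indicator A :: 'w \<Rightarrow> real)"
  proof (rule integral_dominated_convergence[where w = "\<lambda>_. 1"])
    show "AE \<omega> in M. (\<lambda>n. indicator (A' n) \<omega> :: real) \<longlonglongrightarrow> indicator A \<omega>"
    proof (intro AE_I2)
      fix \<omega> assume \<omega>: "\<omega> \<in> space M"
      obtain e where e: "e > 0" "\<And>u. s \<le> u \<Longrightarrow> u < s + e \<Longrightarrow> \<sigma> \<omega> u = \<sigma> \<omega> s"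
        using right_constant[OF \<omega> s(1)] by blast
      have "(\<lambda>n. t * inverse (real (Suc n))) \<longlonglongrightarrow> t * 0"
        by (intro tendsto_intros LIMSEQ_inverse_real_of_nat)
      then have "\<forall>\<^sub>F n in sequentially. t * inverse (real (Suc n)) < e"
        using e(1) by (intro order_tendstoD(2)[of _ "t * 0"]) auto
      then have "\<forall>\<^sub>F n in sequentially. indicator (A' n) \<omega> = (indicator A \<omega> :: real)"
      proof (rule eventually_mono)
        fix n assume "t * inverse (real (Suc n)) < e"
        then have "\<sigma> \<omega> (s + t / real (Suc n)) = \<sigma> \<omega> s"
          using t by (intro e(2)) (auto simp: divide_inverse)
        then show "indicator (A' n) \<omega> = (indicator A \<omega> :: real)"
          by (simp add: A_def A'_def indicator_def)
      qed
      then show "(\<lambda>n. indicator (A' n) \<omega> :: real) \<longlonglongrightarrow> indicator A \<omega>" by (rule tendsto_eventually)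
    qed
  qed (use meas in \<open>auto simp: indicator_def\<close>)
  then have "(\<lambda>n. prob (A' n)) \<longlonglongrightarrow> prob A" using meas by simp
  moreover have "prob A > 0" unfolding A_def law[OF s(1)] by (rule s(2))
  ultimately have "\<forall>\<^sub>F n in sequentially. prob (A' n) > 0" by (intro order_tendstoD(1))
  then obtain n where n: "prob (A' n) > 0" by (meson eventually_happens' sequentially_bot)
  define h where "h = t / real (Suc n)"
  have h: "h > 0" unfolding h_def using \<open>t > 0\<close> by simp
  have "prob (A' n) = Pt s \<sigma>0 k * Pt h k k"
    unfolding A'_def h_def[symmetric] using two_time_law[of s "s + h" k k] law[OF s(1), of k] s(1) h by simp
  then have hk: "Pt h k k > 0" using n s(2) by (simp add: zero_less_mult_iff)
  have "Pt (real (Suc m) * h) k k > 0" for m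
  proof (induction m)
    case 0
    show ?case using hk by simp
  next
    case (Suc m)
    have "Pt (real (Suc m) * h + h) k k \<ge> Pt (real (Suc m) * h) k k * Pt h k k"
      using h by (intro transition_step_le[OF tf]) auto
    moreover have "Pt (real (Suc m) * h) k k * Pt h k k > 0" using Suc hk by (rule mult_pos_pos)
    moreover have "real (Suc (Suc m)) * h = real (Suc m) * h + h" by (simp add: algebra_simps)
    ultimately show ?case by simp
  qed
  then show ?thesis using \<open>t > 0\<close> unfolding h_def by (metis nonzero_mult_div_cancel_left of_nat_Suc of_nat_neq_0 times_divide_eq_right)
qed

lemma init_reachable: "\<sigma>0 \<in> reachable"
  unfolding reachable_def using transition_functionD(3)[OF tf, of \<sigma>0 \<sigma>0] by (auto intro!: exI[of _ 0])

lemma convergence: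
  obtains T r where "T > 0" "0 \<le> r" "r < 1"
    "\<And>k j m t. k \<in> reachable \<Longrightarrow> t \<ge> real m * T \<Longrightarrow> \<bar>Pt t k j - \<pi> j\<bar> \<le> r ^ m"
proof (rule unique_stationary_convergence[OF tf stat unique, of reachable])
  show "reachable \<noteq> {}" using init_reachable by blast
qed (use reachable_closed reachable_diag_pos that in blast)+

lemma expectation_law:
  fixes \<phi> :: "'s \<Rightarrow> real"
  assumes "t \<ge> 0"
  shows "expectation (\<lambda>\<omega>. \<phi> (\<sigma> \<omega> t)) = (\<Sum>k\<in>UNIV. Pt t \<sigma>0 k * \<phi> k)"
proof -
  have "\<phi> (\<sigma> \<omega> t) = (\<Sum>k\<in>UNIV. \<phi> k * indicator {\<omega>\<in>space M. \<sigma> \<omega> t = k} \<omega>)" if "\<omega> \<in> space M" for \<omega>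
    using that by (simp add: indicator_def if_distrib[of "(*) _"] cong: if_cong)
  then have "expectation (\<lambda>\<omega>. \<phi> (\<sigma> \<omega> t)) = expectation (\<lambda>\<omega>. \<Sum>k\<in>UNIV. \<phi> k * indicator {\<omega>\<in>space M. \<sigma> \<omega> t = k} \<omega>)"
    by (intro Bochner_Integration.integral_cong) auto
  also have "\<dots> = (\<Sum>k\<in>UNIV. \<phi> k * prob {\<omega>\<in>space M. \<sigma> \<omega> t = k})"
    by (subst Bochner_Integration.integral_sum) (auto intro!: integrable_mult_right sum.cong simp: emeasure_eq_measure)
  finally show ?thesis by (simp add: law[OF assms] mult.commute)
qed

lemma stationary_limit:
  fixes \<phi> :: "'s \<Rightarrow> real"
  shows "((\<lambda>m. expectation (\<lambda>\<omega>. \<phi> (\<sigma> \<omega> (real m)))) \<longlonglongrightarrow> (\<Sum>k\<in>UNIV. \<pi> k * \<phi> k))"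
proof -
  obtain T r where T: "T > 0" and r: "0 \<le> r" "r < 1"
    and conv: "\<And>k j m t. k \<in> reachable \<Longrightarrow> t \<ge> real m * T \<Longrightarrow> \<bar>Pt t k j - \<pi> j\<bar> \<le> r ^ m"
    using convergence by blast
  have "(\<lambda>m. Pt (real m) \<sigma>0 k) \<longlonglongrightarrow> \<pi> k" for k
  proof (rule metric_LIMSEQ_I)
    fix e :: real assume "e > 0"
    then obtain N where N: "r ^ N < e" using real_arch_pow_inv[of e r] r by blast
    obtain m0 where m0: "real m0 \<ge> real N * T" using real_arch_simple by blast
    have "dist (Pt (real m) \<sigma>0 k) (\<pi> k) < e" if "m \<ge> m0" for m
      using conv[OF init_reachable, of N "real m" k] m0 that N by (simp add: dist_real_def)
    then show "\<exists>no. \<forall>n\<ge>no. dist (Pt (real n) \<sigma>0 k) (\<pi> k) < e" by blast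
  qed
  then show ?thesis unfolding expectation_law[OF of_nat_0_le_iff] by (intro tendsto_intros)
qed

lemma correlation_bound:
  fixes h :: "'s \<Rightarrow> real"
  assumes centred: "(\<Sum>k\<in>UNIV. \<pi> k * h k) = 0"
    and conv: "\<And>k j m t. k \<in> reachable \<Longrightarrow> t \<ge> real m * T \<Longrightarrow> \<bar>Pt t k j - \<pi> j\<bar> \<le> r ^ m"
    and st: "0 \<le> s" "s < t" "t - s \<ge> real m * T"
  shows "\<bar>expectation (\<lambda>\<omega>. h (\<sigma> \<omega> s) * h (\<sigma> \<omega> t))\<bar> \<le> (\<Sum>k\<in>UNIV. \<bar>h k\<bar>)\<^sup>2 * r ^ m"
proof -
  define H where "H = (\<Sum>k\<in>UNIV. \<bar>h k\<bar>)"
  have h_le: "\<bar>h k\<bar> \<le> H" for k unfolding H_def by (intro member_le_sum) auto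
  note P = transition_functionD[OF tf]
  define W where "W k j = {\<omega>\<in>space M. \<sigma> \<omega> s = k \<and> \<sigma> \<omega> t = j}" for k j
  have W: "W k j \<in> sets M" for k j unfolding W_def by measurable
  have "h (\<sigma> \<omega> s) * h (\<sigma> \<omega> t) = (\<Sum>k\<in>UNIV. \<Sum>j\<in>UNIV. h k * h j * indicator (W k j) \<omega>)"
    if "\<omega> \<in> space M" for \<omega>
  proof -
    have "(\<Sum>j\<in>UNIV. h k * h j * indicator (W k j) \<omega>) = (if \<sigma> \<omega> s = k then h k * h (\<sigma> \<omega> t) else 0)" for k
      using that unfolding W_def by (simp add: indicator_def if_distrib[of "(*) _"] cong: if_cong)
    then show ?thesis by simp
  qed
  then have "expectation (\<lambda>\<omega>. h (\<sigma> \<omega> s) * h (\<sigma> \<omega> t))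
      = expectation (\<lambda>\<omega>. \<Sum>k\<in>UNIV. \<Sum>j\<in>UNIV. h k * h j * indicator (W k j) \<omega>)"
    by (intro Bochner_Integration.integral_cong) auto
  also have "\<dots> = (\<Sum>k\<in>UNIV. \<Sum>j\<in>UNIV. h k * h j * prob (W k j))"
    using W by (simp add: Bochner_Integration.integral_sum emeasure_eq_measure del: sum_mult_indicator)
  also have "\<dots> = (\<Sum>k\<in>UNIV. Pt s \<sigma>0 k * (h k * (\<Sum>j\<in>UNIV. Pt (t - s) k j * h j)))"
    unfolding W_def two_time_law[OF st(1,2)] law[OF st(1)] by (simp add: sum_distrib_left mult_ac)
  finally have E: "expectation (\<lambda>\<omega>. h (\<sigma> \<omega> s) * h (\<sigma> \<omega> t)) = \<dots>" .
  have summand: "\<bar>Pt s \<sigma>0 k * (h k * (\<Sum>j\<in>UNIV. Pt (t - s) k j * h j))\<bar> \<le> Pt s \<sigma>0 k * (H * (r ^ m * H))" for k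
  proof (cases "Pt s \<sigma>0 k = 0")
    case False
    then have k: "k \<in> reachable" unfolding reachable_def using P(1)[OF st(1), of \<sigma>0 k] st(1)
      by (auto intro!: exI[of _ s])
    have "(\<Sum>j\<in>UNIV. Pt (t - s) k j * h j) = (\<Sum>j\<in>UNIV. (Pt (t - s) k j - \<pi> j) * h j)"
      using centred by (simp add: left_diff_distrib sum_subtractf)
    also have "\<bar>\<dots>\<bar> \<le> (\<Sum>j\<in>UNIV. \<bar>(Pt (t - s) k j - \<pi> j) * h j\<bar>)" by (rule sum_abs)
    also have "\<dots> \<le> (\<Sum>j\<in>UNIV. r ^ m * \<bar>h j\<bar>)"
      unfolding abs_mult by (intro sum_mono mult_right_mono conv k st(3)) auto
    also have "\<dots> = r ^ m * H" unfolding H_def by (simp add: sum_distrib_left)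
    finally have "\<bar>h k * (\<Sum>j\<in>UNIV. Pt (t - s) k j * h j)\<bar> \<le> H * (r ^ m * H)"
      unfolding abs_mult using h_le[of k] by (intro mult_mono) (auto intro: order_trans[OF abs_ge_zero])
    then show ?thesis
      unfolding abs_mult[of "Pt s \<sigma>0 k"] using P(1)[OF st(1), of \<sigma>0 k] by (simp add: mult_left_mono)
  qed simp
  have "\<bar>expectation (\<lambda>\<omega>. h (\<sigma> \<omega> s) * h (\<sigma> \<omega> t))\<bar> \<le> (\<Sum>k\<in>UNIV. Pt s \<sigma>0 k * (H * (r ^ m * H)))"
    unfolding E by (rule order_trans[OF sum_abs sum_mono]) (rule summand)
  also have "\<dots> = H * (r ^ m * H)" using P(2)[OF st(1), of \<sigma>0] by (simp flip: sum_distrib_right)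
  finally show ?thesis unfolding H_def by (simp add: power2_eq_square mult_ac)
qed

lemma path_right_constant:
  assumes "\<omega> \<in> space M" "t \<ge> 0"
  shows "\<exists>e>0. \<forall>s. t \<le> s \<and> s < t + e \<longrightarrow> g (\<sigma> \<omega> s) = g (\<sigma> \<omega> t)"
  using right_constant[OF assms] by metis

lemma abs_le_sum_abs: "\<bar>g k\<bar> \<le> (\<Sum>k\<in>UNIV. \<bar>g k\<bar>)" for g :: "'s \<Rightarrow> real"
  by (rule member_le_sum) auto

lemma path_integrable:
  fixes g :: "'s \<Rightarrow> real"
  assumes "\<omega> \<in> space M" "0 \<le> a"
  shows "(\<lambda>s. g (\<sigma> \<omega> s)) integrable_on {a..b}"
proof (cases "a < b")
  case True
  have "(\<lambda>s. g (\<sigma> \<omega> s)) integrable_on {a..a + (b - a)}"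
    by (rule right_constant_riemann_sums(1)[OF abs_le_sum_abs path_right_constant[OF assms(1)] assms(2)])
      (use True in auto)
  then show ?thesis by simp
next
  case False
  then show ?thesis 
    by (cases "a = b") (use integrable_on_refl[of "\<lambda>s. g (\<sigma> \<omega> s)" b] in auto)
qed

lemma path_integral_bound:
  fixes g :: "'s \<Rightarrow> real"
  assumes "\<omega> \<in> space M" "0 \<le> a" "a \<le> b"
  shows "\<bar>integral {a..b} (\<lambda>s. g (\<sigma> \<omega> s))\<bar> \<le> (\<Sum>k\<in>UNIV. \<bar>g k\<bar>) * (b - a)"
  using has_integral_bound_real[of "\<Sum>k\<in>UNIV. \<bar>g k\<bar>" "{}" "\<lambda>s. g (\<sigma> \<omega> s)" _ a b]
    path_integrable[OF assms(1,2), of g b] abs_le_sum_abs[of g] assms(3)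
  by (auto simp: has_integral_integral sum_nonneg)

lemma block_averages_vanish:
  fixes h :: "'s \<Rightarrow> real"
  assumes centred: "(\<Sum>k\<in>UNIV. \<pi> k * h k) = 0"
  obtains T where "T > 0"
    "AE \<omega> in M. (\<lambda>n. integral {0..T * (real n)\<^sup>2} (\<lambda>s. h (\<sigma> \<omega> s)) / (T * (real n)\<^sup>2)) \<longlonglongrightarrow> 0"
proof -
  obtain T r where T: "T > 0" and r: "0 \<le> r" "r < 1"
    and conv: "\<And>k j m t. k \<in> reachable \<Longrightarrow> t \<ge> real m * T \<Longrightarrow> \<bar>Pt t k j - \<pi> j\<bar> \<le> r ^ m"
    using convergence by blast
  define H where "H = (\<Sum>k\<in>UNIV. \<bar>h k\<bar>)"
  have h_le: "\<bar>h k\<bar> \<le> H" for k unfolding H_def by (rule abs_le_sum_abs)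
  have H0: "H \<ge> 0" unfolding H_def by (intro sum_nonneg) auto
  define \<tau> where "\<tau> n m a = real m * T + T * real (Suc a) / real (Suc n)" for n m a
  define U where "U n m \<omega> = (\<Sum>a<Suc n. h (\<sigma> \<omega> (\<tau> n m a))) / real (Suc n)" for n m \<omega>
  define Z where "Z m \<omega> = integral {real m * T..real m * T + T} (\<lambda>s. h (\<sigma> \<omega> s)) / T" for m \<omega>
  have U_lim: "(\<lambda>n. U n m \<omega>) \<longlonglongrightarrow> Z m \<omega>" if "\<omega> \<in> space M" for m \<omega>
    unfolding U_def Z_def \<tau>_def using T h_le path_right_constant[OF that]
    by (intro right_constant_riemann_sums(2)[where B = H]) auto
  have U_meas[measurable]: "U n m \<in> borel_measurable M" for n m
    unfolding U_def by measurable
  have Z_meas: "Z m \<in> borel_measurable M" for m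
    by (rule borel_measurable_LIMSEQ_real[OF U_lim]) auto
  have U_bnd: "\<bar>U n m \<omega>\<bar> \<le> H" for n m \<omega>
  proof -
    have "\<bar>\<Sum>a<Suc n. h (\<sigma> \<omega> (\<tau> n m a))\<bar> \<le> (\<Sum>a<Suc n. H)"
      by (rule order_trans[OF sum_abs sum_mono]) (rule h_le)
    then have "\<bar>\<Sum>a<Suc n. h (\<sigma> \<omega> (\<tau> n m a))\<bar> \<le> real (Suc n) * H" by simp
    then show ?thesis unfolding U_def abs_divide by (simp add: divide_le_eq mult.commute)
  qed
  have Z_bnd: "\<bar>Z m \<omega>\<bar> \<le> H" if "\<omega> \<in> space M" for m \<omega>
    by (rule LIMSEQ_le_const2[OF tendsto_rabs[OF U_lim[OF that]]]) (use U_bnd in auto)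
  have corrU: "\<bar>expectation (\<lambda>\<omega>. U n m \<omega> * U n l \<omega>)\<bar> \<le> H\<^sup>2 * r ^ (l - Suc m)" if ml: "m < l" for n m l
  proof -
    define N where "N = real (Suc n)"
    have N: "N > 0" unfolding N_def by simp
    have int: "integrable M (\<lambda>\<omega>. h (\<sigma> \<omega> s) * h (\<sigma> \<omega> t))" for s t
    proof (rule integrable_const_bound[where B = "H * H"])
      show "AE \<omega> in M. norm (h (\<sigma> \<omega> s) * h (\<sigma> \<omega> t)) \<le> H * H"
        using h_le H0 by (intro AE_I2) (auto simp: abs_mult intro!: mult_mono)
    qed measurable
    have "U n m \<omega> * U n l \<omega> = (\<Sum>a<Suc n. \<Sum>b<Suc n. h (\<sigma> \<omega> (\<tau> n m a)) * h (\<sigma> \<omega> (\<tau> n l b))) / N\<^sup>2" for \<omega>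
      unfolding U_def N_def by (simp only: sum_product power2_eq_square times_divide_times_eq)
    moreover define S where "S = (\<Sum>a<Suc n. \<Sum>b<Suc n. expectation (\<lambda>\<omega>. h (\<sigma> \<omega> (\<tau> n m a)) * h (\<sigma> \<omega> (\<tau> n l b))))"
    ultimately have E: "expectation (\<lambda>\<omega>. U n m \<omega> * U n l \<omega>) = S / N\<^sup>2"
      using int by (simp add: Bochner_Integration.integral_sum del: sum.lessThan_Suc)
    have "\<bar>S\<bar> \<le> (\<Sum>a<Suc n. \<Sum>b<Suc n. H\<^sup>2 * r ^ (l - Suc m))"
      unfolding S_def
    proof (rule order_trans[OF sum_abs sum_mono], rule order_trans[OF sum_abs sum_mono])
      fix a b assume "a \<in> {..<Suc n}" "b \<in> {..<Suc n}"
      then have "T * real (Suc a) / N \<le> T" "T * real (Suc b) / N > 0" "T * real (Suc a) / N > 0"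
        using T N by (auto simp: N_def divide_le_eq simp del: of_nat_Suc intro!: divide_pos_pos mult_pos_pos)
      moreover have "real l * T = real m * T + real (l - Suc m) * T + T"
        using ml by (simp add: of_nat_diff algebra_simps)
      moreover have "real (l - Suc m) * T \<ge> 0" "real m * T \<ge> 0" using T by auto
      ultimately have "0 \<le> \<tau> n m a" "\<tau> n m a < \<tau> n l b" "\<tau> n l b - \<tau> n m a \<ge> real (l - Suc m) * T"
        unfolding \<tau>_def N_def[symmetric] by linarith+
      then show "\<bar>expectation (\<lambda>\<omega>. h (\<sigma> \<omega> (\<tau> n m a)) * h (\<sigma> \<omega> (\<tau> n l b)))\<bar> \<le> H\<^sup>2 * r ^ (l - Suc m)"
        unfolding H_def by (intro correlation_bound[OF centred, of T r] conv)
    qed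
    also have "\<dots> = N\<^sup>2 * (H\<^sup>2 * r ^ (l - Suc m))"
      unfolding N_def by (simp add: power2_eq_square del: sum.lessThan_Suc of_nat_Suc)
    finally show ?thesis unfolding E abs_divide using N by (simp add: divide_le_eq mult.commute)
  qed
  have corr: "\<bar>expectation (\<lambda>\<omega>. Z m \<omega> * Z l \<omega>)\<bar> \<le> H\<^sup>2 * r ^ (l - Suc m)" if ml: "m < l" for m l
  proof (rule LIMSEQ_le_const2[OF tendsto_rabs])
    show "(\<lambda>n. expectation (\<lambda>\<omega>. U n m \<omega> * U n l \<omega>)) \<longlonglongrightarrow> expectation (\<lambda>\<omega>. Z m \<omega> * Z l \<omega>)"
    proof (rule integral_dominated_convergence[where w = "\<lambda>_. H * H"])
      show "AE \<omega> in M. (\<lambda>n. U n m \<omega> * U n l \<omega>) \<longlonglongrightarrow> Z m \<omega> * Z l \<omega>"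
        by (intro AE_I2 tendsto_mult U_lim)
      show "AE \<omega> in M. norm (U n m \<omega> * U n l \<omega>) \<le> H * H" for n
        using U_bnd H0 by (intro AE_I2) (auto simp: abs_mult intro!: mult_mono)
    qed (use Z_meas in auto)
    show "\<exists>N. \<forall>n\<ge>N. \<bar>expectation (\<lambda>\<omega>. U n m \<omega> * U n l \<omega>)\<bar> \<le> H\<^sup>2 * r ^ (l - Suc m)"
      using corrU[OF ml] by blast
  qed
  have sumZ: "(\<Sum>m<N. Z m \<omega>) = integral {0..T * real N} (\<lambda>s. h (\<sigma> \<omega> s)) / T" if "\<omega> \<in> space M" for N \<omega>
  proof (induction N)
    case (Suc N)
    have eq: "integral {0..real N * T} (\<lambda>s. h (\<sigma> \<omega> s)) + integral {real N * T..real N * T + T} (\<lambda>s. h (\<sigma> \<omega> s))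
        = integral {0..real N * T + T} (\<lambda>s. h (\<sigma> \<omega> s))"
      using T by (intro Henstock_Kurzweil_Integration.integral_combine path_integrable that) auto
    have "T * real (Suc N) = real N * T + T" by (simp add: algebra_simps)
    then show ?case
      unfolding sum.lessThan_Suc Suc unfolding Z_def by (simp only: eq[symmetric] add_divide_distrib mult.commute[of T "real N"])
  qed simp
  have "AE \<omega> in M. (\<lambda>j. (\<Sum>m<(Suc j)\<^sup>2. Z m \<omega>) / real ((Suc j)\<^sup>2)) \<longlonglongrightarrow> 0"
    by (rule bounded_decorrelated_averages[OF Z_meas Z_bnd corr r])
  then have "AE \<omega> in M. (\<lambda>n. integral {0..T * (real n)\<^sup>2} (\<lambda>s. h (\<sigma> \<omega> s)) / (T * (real n)\<^sup>2)) \<longlonglongrightarrow> 0"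
  proof (rule AE_mp, intro AE_I2 impI)
    fix \<omega> assume \<omega>: "\<omega> \<in> space M" and "(\<lambda>j. (\<Sum>m<(Suc j)\<^sup>2. Z m \<omega>) / real ((Suc j)\<^sup>2)) \<longlonglongrightarrow> 0"
    then have "(\<lambda>j. integral {0..T * (real (Suc j))\<^sup>2} (\<lambda>s. h (\<sigma> \<omega> s)) / (T * (real (Suc j))\<^sup>2)) \<longlonglongrightarrow> 0"
      unfolding sumZ[OF \<omega>] by (simp add: divide_divide_eq_left del: of_nat_Suc)
    then show "(\<lambda>n. integral {0..T * (real n)\<^sup>2} (\<lambda>s. h (\<sigma> \<omega> s)) / (T * (real n)\<^sup>2)) \<longlonglongrightarrow> 0"
      by (rule LIMSEQ_imp_Suc)
  qed
  then show thesis using that[OF T] by blast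
qed

lemma negative_mean_path_integral:
  fixes g :: "'s \<Rightarrow> real"
  assumes neg: "(\<Sum>k\<in>UNIV. \<pi> k * g k) < 0"
  shows "AE \<omega> in M. filterlim (\<lambda>t. integral {0..t} (\<lambda>s. g (\<sigma> \<omega> s))) at_bot at_top"
proof -
  define \<gamma> where "\<gamma> = - (\<Sum>k\<in>UNIV. \<pi> k * g k)"
  have \<gamma>: "\<gamma> > 0" unfolding \<gamma>_def using neg by simp
  have one: "(\<Sum>k\<in>UNIV. \<pi> k) = 1" using stat unfolding stationary_distribution_def by blast
  have "(\<Sum>k\<in>UNIV. \<pi> k * (g k + \<gamma>)) = (\<Sum>k\<in>UNIV. \<pi> k * g k) + (\<Sum>k\<in>UNIV. \<pi> k) * \<gamma>"
    by (simp add: distrib_left sum.distrib sum_distrib_right)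
  then have "(\<Sum>k\<in>UNIV. \<pi> k * (g k + \<gamma>)) = 0" unfolding one \<gamma>_def by simp
  then obtain T where T: "T > 0" and
    avg: "AE \<omega> in M. (\<lambda>n. integral {0..T * (real n)\<^sup>2} (\<lambda>s. g (\<sigma> \<omega> s) + \<gamma>) / (T * (real n)\<^sup>2)) \<longlonglongrightarrow> 0"
    using block_averages_vanish[of "\<lambda>k. g k + \<gamma>"] by blast
  define B where "B = (\<Sum>k\<in>UNIV. \<bar>g k\<bar>)"
  have B: "B \<ge> 0" unfolding B_def by (intro sum_nonneg) auto
  from avg show ?thesis
  proof (rule AE_mp, intro AE_I2 impI)
    fix \<omega> assume \<omega>: "\<omega> \<in> space M"
    define I where "I t = integral {0..t} (\<lambda>s. g (\<sigma> \<omega> s))" for t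
    define Q where "Q n = integral {0..T * (real n)\<^sup>2} (\<lambda>s. g (\<sigma> \<omega> s) + \<gamma>) / (T * (real n)\<^sup>2)" for n
    assume "(\<lambda>n. integral {0..T * (real n)\<^sup>2} (\<lambda>s. g (\<sigma> \<omega> s) + \<gamma>) / (T * (real n)\<^sup>2)) \<longlonglongrightarrow> 0"
    then have Q: "Q \<longlonglongrightarrow> 0" unfolding Q_def .
    define a where "a n = (Q n - \<gamma> + 3 * B / real n) * (T * (real n)\<^sup>2)" for n
    have a_bot: "filterlim a at_bot sequentially"
      unfolding a_def
    proof (rule filterlim_tendsto_neg_mult_at_bot)
      show "(\<lambda>n. Q n - \<gamma> + 3 * B / real n) \<longlonglongrightarrow> 0 - \<gamma> + 0"
        by (intro tendsto_intros Q lim_const_over_n)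
      show "0 - \<gamma> + 0 < 0" using \<gamma> by simp
      show "filterlim (\<lambda>n. T * (real n)\<^sup>2) at_top sequentially"
        using T by (intro filterlim_tendsto_pos_mult_at_top[OF tendsto_const] filterlim_pow_at_top filterlim_real_sequentially) auto
    qed
    define \<nu> where "\<nu> t = nat \<lfloor>sqrt (t / T)\<rfloor>" for t
    have \<nu>: "filterlim \<nu> sequentially at_top"
      unfolding filterlim_at_top
    proof
      fix Z :: nat
      show "\<forall>\<^sub>F t in at_top. Z \<le> \<nu> t"
        using eventually_ge_at_top[of "T * (real Z)\<^sup>2"]
      proof (rule eventually_mono)
        fix t assume "T * (real Z)\<^sup>2 \<le> t"
        then have "(real Z)\<^sup>2 \<le> t / T" using T by (simp add: field_simps)
        then have "real Z \<le> sqrt (t / T)" by (rule real_le_rsqrt)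
        then show "Z \<le> \<nu> t" unfolding \<nu>_def by (simp add: le_nat_floor)
      qed
    qed
    have le: "I t \<le> a (\<nu> t)" if t: "t \<ge> T" for t
    proof -
      define n where "n = \<nu> t"
      have "t / T \<ge> 1" using t T by simp
      then have q1: "sqrt (t / T) \<ge> 1" by simp
      have n1: "n \<ge> 1" unfolding n_def \<nu>_def using q1 by (simp add: le_nat_floor)
      have n_le: "real n \<le> sqrt (t / T)" "sqrt (t / T) < real n + 1"
        unfolding n_def \<nu>_def using q1 by (auto simp: of_nat_nat)
      have "(real n)\<^sup>2 \<le> t / T" "t / T \<le> (real n + 1)\<^sup>2"
        using power_mono[OF n_le(1), of 2] power_mono[OF less_imp_le[OF n_le(2)], of 2] \<open>t / T \<ge> 1\<close> by simp_all
      then have sq: "T * (real n)\<^sup>2 \<le> t" "t \<le> T * (real n + 1)\<^sup>2"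
        using T t by (auto simp: field_simps)
      define c where "c = T * (real n)\<^sup>2"
      have c: "c > 0" "c \<le> t" using T n1 sq(1) by (auto simp: c_def)
      have "I t = I c + integral {c..t} (\<lambda>s. g (\<sigma> \<omega> s))"
        unfolding I_def using c by (intro Henstock_Kurzweil_Integration.integral_combine[symmetric] path_integrable \<omega>) auto
      moreover have "I c = (Q n - \<gamma>) * c"
      proof -
        have "integral {0..c} (\<lambda>s. g (\<sigma> \<omega> s) + \<gamma>) = I c + integral {0..c} (\<lambda>s. \<gamma>)"
          unfolding I_def by (rule Henstock_Kurzweil_Integration.integral_add[OF path_integrable[OF \<omega>]]) auto
        then have "Q n * c = I c + \<gamma> * c"
          unfolding Q_def c_def[symmetric] using c by simp
        then show ?thesis by (simp add: algebra_simps)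
      qed
      moreover have "integral {c..t} (\<lambda>s. g (\<sigma> \<omega> s)) \<le> 3 * B / real n * c"
      proof -
        have "integral {c..t} (\<lambda>s. g (\<sigma> \<omega> s)) \<le> B * (t - c)"
          unfolding B_def using path_integral_bound[OF \<omega>, of c t g] c by auto
        also have "\<dots> \<le> B * (3 * T * real n)"
        proof (intro mult_left_mono B)
          have "t - c \<le> T * (2 * real n + 1)" using sq(2) unfolding c_def by (simp add: power2_eq_square algebra_simps)
          also have "\<dots> \<le> T * (3 * real n)" using T n1 by (intro mult_left_mono) auto
          finally show "t - c \<le> 3 * T * real n" by (simp add: mult_ac)
        qed
        also have "\<dots> = 3 * B / real n * c" unfolding c_def using n1 by (simp add: power2_eq_square)
        finally show ?thesis .
      qed
      ultimately have "I t \<le> (Q n - \<gamma> + 3 * B / real n) * c" by (simp add: distrib_right)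
      then show ?thesis unfolding a_def n_def[symmetric] c_def .
    qed
    have "filterlim (\<lambda>t. a (\<nu> t)) at_bot at_top" by (rule filterlim_compose[OF a_bot \<nu>])
    moreover have "\<forall>\<^sub>F t in at_top. I t \<le> a (\<nu> t)" using eventually_ge_at_top[of T] by (rule eventually_mono) (rule le)
    ultimately show "filterlim (\<lambda>t. integral {0..t} (\<lambda>s. g (\<sigma> \<omega> s))) at_bot at_top"
      unfolding I_def by (rule filterlim_at_bot_mono)
  qed
qed

end

section \<open>Pathwise estimates for the switched model\<close>

lemma right_derivative_nonincreasing:
  fixes \<phi> :: "real \<Rightarrow> real"
  assumes "a \<le> b" and cont: "continuous_on {a..b} \<phi>"
    and der: "\<And>t. a \<le> t \<Longrightarrow> t < b \<Longrightarrow> \<exists>D\<le>0. (\<phi> has_real_derivative D) (at_right t)"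
  shows "\<phi> b \<le> \<phi> a"
proof (rule ccontr)
  assume "\<not> \<phi> b \<le> \<phi> a"
  then have gt: "\<phi> b > \<phi> a" by simp
  then have "a < b" using \<open>a \<le> b\<close> by (cases "a = b") auto
  define \<epsilon> where "\<epsilon> = (\<phi> b - \<phi> a) / (2 * (b - a))"
  have \<epsilon>: "\<epsilon> > 0" unfolding \<epsilon>_def using gt \<open>a < b\<close> by simp
  define \<psi> where "\<psi> t = \<phi> t - \<phi> a - \<epsilon> * (t - a)" for t
  have half: "w / (2 * d) * d = w / 2" if "d \<noteq> 0" for w d :: real using that by simp
  have eq: "\<epsilon> * (b - a) = (\<phi> b - \<phi> a) / 2" unfolding \<epsilon>_def by (rule half) (use \<open>a < b\<close> in simp)
  have \<psi>b: "\<psi> b > 0" unfolding \<psi>_def eq using gt by (simp add: field_simps)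
  have c\<psi>: "continuous_on {a..b} \<psi>" unfolding \<psi>_def by (intro continuous_intros cont)
  define Z where "Z = {t\<in>{a..b}. \<psi> t \<le> 0}"
  have "closed Z" unfolding Z_def using c\<psi> by (intro continuous_closed_preimage_constant continuous_on_closed_Collect_le) auto
  moreover have aZ: "a \<in> Z" unfolding Z_def \<psi>_def using \<open>a \<le> b\<close> by simp
  moreover have bdd: "bdd_above Z" unfolding Z_def by (auto intro: bdd_aboveI)
  ultimately have cZ: "Sup Z \<in> Z" by (intro closed_contains_Sup) auto
  define c where "c = Sup Z"
  have c: "a \<le> c" "c < b" "\<psi> c \<le> 0"
    using cZ \<psi>b unfolding c_def Z_def by (auto simp: order.order_iff_strict)
  obtain D where D: "D \<le> 0" "(\<phi> has_real_derivative D) (at_right c)" using der[OF c(1,2)] by blast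
  have "(\<psi> has_real_derivative (D - \<epsilon>)) (at_right c)"
    unfolding \<psi>_def by (rule derivative_eq_intros D(2) refl | simp)+
  then obtain d where d: "d > 0" "\<And>h. h > 0 \<Longrightarrow> h < d \<Longrightarrow> \<psi> (c + h) < \<psi> c"
    using has_real_derivative_neg_dec_right[of \<psi> "D - \<epsilon>" c "{c<..}"] D(1) \<epsilon> by auto
  define h where "h = min (d / 2) (b - c)"
  have h: "h > 0" "h < d" "c + h \<le> b" unfolding h_def using d(1) c by auto
  then have "c + h \<in> Z" unfolding Z_def using d(2)[of h] c by auto
  then have "c + h \<le> c" unfolding c_def using bdd by (intro cSup_upper)
  then show False using h(1) by simp
qed

lemma indefinite_integral_continuous:
  fixes y :: "real \<Rightarrow> 'a::euclidean_space"
  assumes F: "\<And>t. t \<ge> 0 \<Longrightarrow> (F has_integral (y t - y0)) {0..t}"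
  shows "continuous_on {0..T} y"
proof (cases "T \<ge> 0")
  case True
  have "continuous_on {0..T} (\<lambda>t. y0 + integral {0..t} F)"
    using F[OF True] by (intro continuous_intros indefinite_integral_continuous_1) blast
  moreover have "y0 + integral {0..t} F = y t" if "t \<in> {0..T}" for t
    using F[of t] that by (simp add: integral_unique)
  ultimately show ?thesis by (rule continuous_on_eq)
qed simp

lemma indefinite_integral_right_derivative:
  fixes y :: "real \<Rightarrow> 'a::euclidean_space"
  assumes F: "\<And>t. t \<ge> 0 \<Longrightarrow> (F has_integral (y t - y0)) {0..t}"
    and t: "t \<ge> 0" and e: "e > 0" and cont: "continuous_on {t..<t + e} F"
  shows "(y has_vector_derivative F t) (at_right t)"
proof -
  define b where "b = t + e / 2"
  have b: "t < b" unfolding b_def using e by simp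
  have "continuous_on {t..b} F"
    by (rule continuous_on_subset[OF cont]) (use e in \<open>auto simp: b_def\<close>)
  then have "((\<lambda>u. integral {t..u} F) has_vector_derivative F t) (at t within {t..b})"
    using b by (intro integral_has_vector_derivative) auto
  then have "((\<lambda>u. y t + integral {t..u} F) has_vector_derivative F t) (at t within {t..b})"
    by (auto intro!: derivative_eq_intros)
  then have "(y has_vector_derivative F t) (at t within {t..b})"
  proof (rule has_vector_derivative_transform[rotated 2])
    show "t \<in> {t..b}" using b by simp
    fix u assume u: "u \<in> {t..b}"
    have "integral {0..t} F + integral {t..u} F = integral {0..u} F"
      using u t F[of u] by (intro Henstock_Kurzweil_Integration.integral_combine) auto
    then show "y u = y t + integral {t..u} F"
      using F[of t] F[of u] u t by (simp add: integral_unique algebra_simps)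
  qed
  then show ?thesis using at_within_Icc_at_right[OF b] by simp
qed

lemma negative_part_square_derivative:
  "((\<lambda>y::real. (max 0 (- y))\<^sup>2) has_real_derivative - 2 * max 0 (- y)) (at y)"
proof -
  consider "y > 0" | "y < 0" | "y = 0" by linarith
  then show ?thesis
  proof cases
    case 1
    have "((\<lambda>y. 0) has_real_derivative - 2 * max 0 (- y)) (at y)" using 1 by simp
    then show ?thesis
      by (rule has_field_derivative_transform_within_open[of _ _ _ "{0<..}"]) (use 1 in auto)
  next
    case 2
    have "((\<lambda>y. y\<^sup>2) has_real_derivative - 2 * max 0 (- y)) (at y)"
      using 2 by (auto intro!: derivative_eq_intros)
    then show ?thesis
      by (rule has_field_derivative_transform_within_open[of _ _ _ "{..<0}"]) (use 2 in auto)
  next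
    case 3
    have "(\<lambda>h::real. ((max 0 (- (0 + h)))\<^sup>2 - (max 0 (- 0))\<^sup>2) / h) \<midarrow>0\<rightarrow> 0"
    proof (rule Lim_null_comparison)
      show "\<forall>\<^sub>F h in at 0. norm (((max 0 (- (0 + h)))\<^sup>2 - (max 0 (- 0))\<^sup>2) / h) \<le> \<bar>h::real\<bar>"
        by (rule always_eventually) (auto simp: max_def power2_eq_square)
      show "((\<lambda>h::real. \<bar>h\<bar>) \<longlongrightarrow> 0) (at 0)" by (rule tendsto_rabs_zero[OF tendsto_ident_at])
    qed
    then show ?thesis unfolding 3 DERIV_def by simp
  qed
qed

lemma nimfa_rhs_component:
  "nimfa_rhs \<beta> \<delta> A p $ i = \<beta> * (1 - p $ i) * (\<Sum>j\<in>UNIV. A $ i $ j * p $ j) - \<delta> * p $ i"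
proof -
  have "(\<Sum>j\<in>UNIV. (\<beta> * A $ i $ j - \<delta> * (if i = j then 1 else 0)) * p $ j)
      = \<beta> * (\<Sum>j\<in>UNIV. A $ i $ j * p $ j) - \<delta> * p $ i"
    by (simp add: left_diff_distrib sum_subtractf sum_distrib_left mult.assoc if_distrib[of "\<lambda>c. c * _"]
        if_distrib[of "(*) _"] cong: if_cong)
  moreover have "(\<Sum>j\<in>UNIV. (if i = j then p $ i else 0) * (\<Sum>l\<in>UNIV. A $ j $ l * p $ l))
      = p $ i * (\<Sum>j\<in>UNIV. A $ i $ j * p $ j)"
    by (simp add: if_distrib[of "\<lambda>c. c * _"] cong: if_cong)
  ultimately show ?thesis
    unfolding nimfa_rhs_def
    by (simp add: matrix_vector_mult_def mat_def algebra_simps)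
qed

lemma nimfa_rhs_continuous:
  assumes "continuous_on S x"
  shows "continuous_on S (\<lambda>s. nimfa_rhs \<beta> \<delta> A (x s))"
proof -
  have "continuous_on S (\<lambda>s. \<chi> i. \<beta> * (1 - x s $ i) * (\<Sum>j\<in>UNIV. A $ i $ j * x s $ j) - \<delta> * x s $ i)"
    by (intro continuous_intros assms)
  then show ?thesis by (rule continuous_on_eq) (simp add: vec_eq_iff nimfa_rhs_component)
qed

locale switched_path =
  fixes \<beta> \<delta> :: real and G :: "'s \<Rightarrow> 'v::finite \<Rightarrow> 'v \<Rightarrow> bool" and sig :: "real \<Rightarrow> 's"
    and p0 :: "(real, 'v) vec" and x :: "real \<Rightarrow> (real, 'v) vec"
  assumes beta: "\<beta> > 0" and delta: "\<delta> > 0"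
    and solution: "switched_solution \<beta> \<delta> G sig p0 x"
    and right_constant: "\<And>t. t \<ge> 0 \<Longrightarrow> \<exists>e>0. \<forall>s. t \<le> s \<and> s < t + e \<longrightarrow> sig s = sig t"
    and p0_nonneg: "\<And>i. p0 $ i \<ge> 0"
begin

lemma adj_bounds: "0 \<le> adj G k $ i $ j" "adj G k $ i $ j \<le> 1"
  by (auto simp: adj_def)

lemma integral_equation:
  "t \<ge> 0 \<Longrightarrow> ((\<lambda>s. nimfa_rhs \<beta> \<delta> (adj G (sig s)) (x s)) has_integral (x t - p0)) {0..t}"
  using solution unfolding switched_solution_def by blast

lemma continuous: "continuous_on {0..T} x"
  using integral_equation by (rule indefinite_integral_continuous)

lemma right_derivative:
  assumes "t \<ge> 0"
  shows "(x has_vector_derivative nimfa_rhs \<beta> \<delta> (adj G (sig t)) (x t)) (at_right t)"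
proof -
  obtain e where e: "e > 0" "\<And>s. t \<le> s \<Longrightarrow> s < t + e \<Longrightarrow> sig s = sig t"
    using right_constant[OF assms] by blast
  have "continuous_on {t..<t + e} x"
    by (rule continuous_on_subset[OF continuous[of "t + e"]]) (use assms in auto)
  then have "continuous_on {t..<t + e} (\<lambda>s. nimfa_rhs \<beta> \<delta> (adj G (sig t)) (x s))"
    by (rule nimfa_rhs_continuous)
  then have "continuous_on {t..<t + e} (\<lambda>s. nimfa_rhs \<beta> \<delta> (adj G (sig s)) (x s))"
    by (rule continuous_on_eq) (metis atLeastLessThan_iff e(2))
  then show ?thesis 
    by (intro indefinite_integral_right_derivative[where y = x and ?y0.0 = p0 and e = e
          and F = "\<lambda>s. nimfa_rhs \<beta> \<delta> (adj G (sig s)) (x s)"] integral_equation assms e(1))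
qed

lemma component_right_derivative:
  assumes "t \<ge> 0"
  shows "((\<lambda>s. x s $ i) has_real_derivative nimfa_rhs \<beta> \<delta> (adj G (sig t)) (x t) $ i) (at_right t)"
  using bounded_linear.has_vector_derivative[OF bounded_linear_vec_nth right_derivative[OF assms]]
  by (simp add: has_real_derivative_iff_has_vector_derivative)

lemma nonneg:
  assumes "T \<ge> 0"
  shows "x T $ i \<ge> 0"
proof -
  define n where "n t i = max 0 (- x t $ i)" for t i
  define V where "V t = (\<Sum>i\<in>UNIV. (n t i)\<^sup>2)" for t
  have "bounded (x ` {0..T})"
    by (intro compact_imp_bounded compact_continuous_image continuous) simp
  then obtain K where K: "\<And>t. t \<in> {0..T} \<Longrightarrow> norm (x t) \<le> K" unfolding bounded_iff by blast
  have nK: "n t i \<le> K" if "t \<in> {0..T}" for t i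
    using component_le_norm_cart[of "x t" i] K[OF that] norm_ge_zero[of "x t"] unfolding n_def by linarith
  have K0: "K \<ge> 0" using order_trans[OF norm_ge_zero K[of 0]] assms by simp
  define C where "C = 2 * \<beta> * (1 + K) * real CARD('v)"
  define \<phi> where "\<phi> t = V t * exp (- C * t)" for t
  have "\<phi> T \<le> \<phi> 0"
  proof (rule right_derivative_nonincreasing[OF assms])
    show "continuous_on {0..T} \<phi>"
      unfolding \<phi>_def V_def n_def by (intro continuous_intros continuous)
    fix t assume t: "0 \<le> t" "t < T"
    define R where "R i = nimfa_rhs \<beta> \<delta> (adj G (sig t)) (x t) $ i" for i
    have dn: "((\<lambda>s. (n s i)\<^sup>2) has_real_derivative - 2 * n t i * R i) (at_right t)" for i
      unfolding n_def R_def
      using DERIV_chain2[OF negative_part_square_derivative component_right_derivative[OF t(1)]] .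
    have dV: "(V has_real_derivative (\<Sum>i\<in>UNIV. - 2 * n t i * R i)) (at_right t)"
      unfolding V_def by (intro DERIV_sum dn)
    have dE: "((\<lambda>t. exp (- C * t)) has_real_derivative - C * exp (- C * t)) (at_right t)"
      by (auto intro!: derivative_eq_intros)
    have d\<phi>: "(\<phi> has_real_derivative ((\<Sum>i\<in>UNIV. - 2 * n t i * R i) - C * V t) * exp (- C * t)) (at_right t)"
      unfolding \<phi>_def by (rule DERIV_cong[OF DERIV_mult[OF dV dE]]) (simp add: algebra_simps)
    have n0: "n t i \<ge> 0" for i unfolding n_def by simp
    have comp: "- 2 * n t i * R i \<le> 2 * \<beta> * (1 + K) * (n t i * (\<Sum>j\<in>UNIV. n t j))" for i
    proof (cases "n t i = 0")
      case False
      then have xi: "x t $ i = - n t i" unfolding n_def by (auto simp: max_def split: if_splits)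
      define s where "s = (\<Sum>j\<in>UNIV. adj G (sig t) $ i $ j * x t $ j)"
      have "- s = (\<Sum>j\<in>UNIV. adj G (sig t) $ i $ j * - x t $ j)" unfolding s_def by (simp add: sum_negf)
      also have "\<dots> \<le> (\<Sum>j\<in>UNIV. 1 * n t j)"
      proof (intro sum_mono)
        fix j
        have "adj G (sig t) $ i $ j * - x t $ j \<le> adj G (sig t) $ i $ j * n t j"
          by (intro mult_left_mono adj_bounds) (simp add: n_def)
        also have "\<dots> \<le> 1 * n t j" by (intro mult_right_mono adj_bounds n0)
        finally show "adj G (sig t) $ i $ j * - x t $ j \<le> 1 * n t j" .
      qed
      finally have s: "- s \<le> (\<Sum>j\<in>UNIV. n t j)" by simp
      have "- R i = \<beta> * ((1 + n t i) * (- s)) - \<delta> * n t i"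
        unfolding R_def nimfa_rhs_component s_def[symmetric] xi by (simp add: algebra_simps)
      also have "\<dots> \<le> \<beta> * ((1 + n t i) * (- s))" using delta n0 by simp
      also have "\<dots> \<le> \<beta> * ((1 + n t i) * (\<Sum>j\<in>UNIV. n t j))"
        using beta n0[of i] s by (intro mult_left_mono) auto
      also have "\<dots> \<le> \<beta> * ((1 + K) * (\<Sum>j\<in>UNIV. n t j))"
        using beta n0 nK[of t i] t by (intro mult_left_mono mult_right_mono sum_nonneg) auto
      finally have "2 * n t i * - R i \<le> 2 * n t i * (\<beta> * ((1 + K) * (\<Sum>j\<in>UNIV. n t j)))"
        by (rule mult_left_mono) (simp add: n0)
      then show ?thesis by (simp add: algebra_simps)
    qed simp
    have "(\<Sum>i\<in>UNIV. - 2 * n t i * R i) \<le> (\<Sum>i\<in>UNIV. 2 * \<beta> * (1 + K) * (n t i * (\<Sum>j\<in>UNIV. n t j)))"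
      by (intro sum_mono comp)
    also have "\<dots> = 2 * \<beta> * (1 + K) * (\<Sum>i\<in>UNIV. n t i)\<^sup>2"
      by (simp add: power2_eq_square flip: sum_distrib_left sum_distrib_right)
    also have "\<dots> \<le> 2 * \<beta> * (1 + K) * (V t * real CARD('v))"
      unfolding V_def using beta K0 sum_squared_le_sum_of_squares[of "n t" UNIV] by (intro mult_left_mono) auto
    also have "\<dots> = C * V t" unfolding C_def by simp
    finally have "(\<Sum>i\<in>UNIV. - 2 * n t i * R i) - C * V t \<le> 0" by simp
    then show "\<exists>D\<le>0. (\<phi> has_real_derivative D) (at_right t)"
      using d\<phi> by (intro exI[of _ "((\<Sum>i\<in>UNIV. - 2 * n t i * R i) - C * V t) * exp (- C * t)"])
        (simp add: mult_le_0_iff)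
  qed
  moreover have "x 0 = p0" using solution unfolding switched_solution_def by blast
  then have "n 0 i = 0" for i using p0_nonneg[of i] by (simp add: n_def)
  then have "V 0 = 0" unfolding V_def by simp
  then have "\<phi> 0 = 0" unfolding \<phi>_def by simp
  ultimately have "V T \<le> 0" unfolding \<phi>_def by (simp add: mult_le_0_iff)
  moreover have "(n T i)\<^sup>2 \<le> V T" unfolding V_def by (intro member_le_sum) auto
  ultimately have "(n T i)\<^sup>2 \<le> 0" by linarith
  then have "n T i = 0" by simp
  then show ?thesis unfolding n_def by (auto simp: max_def split: if_splits)
qed

lemma energy_bound:
  assumes rayleigh: "\<And>k w. w \<bullet> (adj G k *v w) \<le> \<Lambda> k * (norm w)\<^sup>2"
    and integrable: "\<And>t. t \<ge> 0 \<Longrightarrow> (\<lambda>s. \<beta> * \<Lambda> (sig s) - \<delta>) integrable_on {0..t}"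
    and T: "T \<ge> 0"
  shows "(norm (x T))\<^sup>2 \<le> (norm p0)\<^sup>2 * exp (2 * integral {0..T} (\<lambda>s. \<beta> * \<Lambda> (sig s) - \<delta>))"
proof -
  define g where "g s = \<beta> * \<Lambda> (sig s) - \<delta>" for s
  define I where "I t = integral {0..t} g" for t
  have hasI: "(g has_integral (I t - 0)) {0..t}" if "t \<ge> 0" for t
    unfolding I_def using integrable[OF that] unfolding g_def by (simp add: integrable_integral)
  have dI: "(I has_real_derivative g t) (at_right t)" if "t \<ge> 0" for t
  proof -
    obtain e where e: "e > 0" "\<And>s. t \<le> s \<Longrightarrow> s < t + e \<Longrightarrow> sig s = sig t"
      using right_constant[OF \<open>t \<ge> 0\<close>] by blast
    have "continuous_on {t..<t + e} (\<lambda>_. g t)" by simp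
    then have "continuous_on {t..<t + e} g"
      by (rule continuous_on_eq) (metis atLeastLessThan_iff e(2) g_def)
    then show ?thesis
      using indefinite_integral_right_derivative[OF hasI that e(1)]
      by (simp add: has_real_derivative_iff_has_vector_derivative)
  qed
  define \<phi> where "\<phi> t = (\<Sum>i\<in>UNIV. (x t $ i)\<^sup>2) * exp (- 2 * I t)" for t
  have norm_sum: "(\<Sum>i\<in>UNIV. (x t $ i)\<^sup>2) = (norm (x t))\<^sup>2" for t
    unfolding power2_norm_eq_inner by (simp add: inner_vec_def power2_eq_square)
  have "\<phi> T \<le> \<phi> 0"
  proof (rule right_derivative_nonincreasing[OF T])
    show "continuous_on {0..T} \<phi>"
      unfolding \<phi>_def using indefinite_integral_continuous[OF hasI]
      by (intro continuous_intros continuous) auto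
    fix t assume t: "0 \<le> t" "t < T"
    define A where "A = adj G (sig t)"
    define R where "R i = nimfa_rhs \<beta> \<delta> A (x t) $ i" for i
    have dS: "((\<lambda>s. \<Sum>i\<in>UNIV. (x s $ i)\<^sup>2) has_real_derivative (\<Sum>i\<in>UNIV. 2 * x t $ i * R i)) (at_right t)"
    proof (intro DERIV_sum)
      fix i
      show "((\<lambda>s. (x s $ i)\<^sup>2) has_real_derivative 2 * x t $ i * R i) (at_right t)"
        using component_right_derivative[OF t(1), of i] unfolding R_def A_def
        by (auto intro!: derivative_eq_intros)
    qed
    have dE: "((\<lambda>t. exp (- 2 * I t)) has_real_derivative - 2 * g t * exp (- 2 * I t)) (at_right t)"
      using dI[OF t(1)] by (auto intro!: derivative_eq_intros)
    have d\<phi>: "(\<phi> has_real_derivative ((\<Sum>i\<in>UNIV. 2 * x t $ i * R i) - 2 * g t * (norm (x t))\<^sup>2) * exp (- 2 * I t)) (at_right t)"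
      unfolding \<phi>_def by (rule DERIV_cong[OF DERIV_mult[OF dS dE]]) (simp add: norm_sum algebra_simps)
    define s where "s i = (\<Sum>j\<in>UNIV. A $ i $ j * x t $ j)" for i
    have x0: "x t $ i \<ge> 0" for i using nonneg t(1) by simp
    have s0: "s i \<ge> 0" for i unfolding s_def A_def using x0 adj_bounds by (intro sum_nonneg) auto
    have "(\<Sum>i\<in>UNIV. 2 * x t $ i * R i) \<le> (\<Sum>i\<in>UNIV. 2 * \<beta> * (x t $ i * s i) - 2 * \<delta> * (x t $ i)\<^sup>2)"
    proof (intro sum_mono)
      fix i
      have "0 \<le> 2 * \<beta> * ((x t $ i)\<^sup>2 * s i)" using beta s0 by simp
      then show "2 * x t $ i * R i \<le> 2 * \<beta> * (x t $ i * s i) - 2 * \<delta> * (x t $ i)\<^sup>2"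
        unfolding R_def nimfa_rhs_component s_def[symmetric] by (simp add: algebra_simps power2_eq_square)
    qed
    also have "\<dots> = 2 * \<beta> * (\<Sum>i\<in>UNIV. x t $ i * s i) - 2 * \<delta> * (norm (x t))\<^sup>2"
      by (simp add: sum_subtractf norm_sum flip: sum_distrib_left)
    also have "(\<Sum>i\<in>UNIV. x t $ i * s i) = x t \<bullet> (A *v x t)"
      unfolding s_def by (simp add: inner_vec_def matrix_vector_mult_def)
    also have "2 * \<beta> * (x t \<bullet> (A *v x t)) - 2 * \<delta> * (norm (x t))\<^sup>2
        \<le> 2 * \<beta> * (\<Lambda> (sig t) * (norm (x t))\<^sup>2) - 2 * \<delta> * (norm (x t))\<^sup>2"
      using beta rayleigh unfolding A_def by (intro diff_right_mono mult_left_mono) auto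
    also have "\<dots> = 2 * g t * (norm (x t))\<^sup>2" unfolding g_def by (simp add: algebra_simps)
    finally have "(\<Sum>i\<in>UNIV. 2 * x t $ i * R i) - 2 * g t * (norm (x t))\<^sup>2 \<le> 0" by simp
    then show "\<exists>D\<le>0. (\<phi> has_real_derivative D) (at_right t)"
      using d\<phi> by (intro exI[of _ "((\<Sum>i\<in>UNIV. 2 * x t $ i * R i) - 2 * g t * (norm (x t))\<^sup>2) * exp (- 2 * I t)"])
        (simp add: mult_le_0_iff)
  qed
  moreover have "x 0 = p0" using solution unfolding switched_solution_def by blast
  then have "\<phi> 0 = (norm p0)\<^sup>2" unfolding \<phi>_def norm_sum I_def by simp
  ultimately have "(norm (x T))\<^sup>2 * exp (- 2 * I T) \<le> (norm p0)\<^sup>2" unfolding \<phi>_def norm_sum by simp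
  then have "(norm (x T))\<^sup>2 * exp (- 2 * I T) * exp (2 * I T) \<le> (norm p0)\<^sup>2 * exp (2 * I T)"
    by (rule mult_right_mono) simp
  then show ?thesis unfolding I_def g_def by (simp add: mult.assoc flip: exp_add)
qed

end

section \<open>Almost sure stability\<close>

lemma (in ergodic_markov) stationary_edges_independent:
  fixes G :: "'s \<Rightarrow> 'v::{finite,linorder} \<Rightarrow> 'v \<Rightarrow> bool" and \<phi> :: "'v \<times> 'v \<Rightarrow> real \<Rightarrow> real"
  assumes indep: "independent_edges M G \<sigma>"
  shows "(\<Sum>k\<in>UNIV. \<pi> k * (\<Prod>e\<in>{(i, j). j < i}. \<phi> e (adj G k $ fst e $ snd e)))
    = (\<Prod>e\<in>{(i, j). j < i}. \<Sum>k\<in>UNIV. \<pi> k * \<phi> e (adj G k $ fst e $ snd e))"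
proof (rule LIMSEQ_unique)
  define E where "E = {(i, j). j < (i::'v)}"
  have finE: "finite E" by simp
  have factor: "expectation (\<lambda>\<omega>. \<Prod>e\<in>E. \<phi> e (adj G (\<sigma> \<omega> t) $ fst e $ snd e))
      = (\<Prod>e\<in>E. expectation (\<lambda>\<omega>. \<phi> e (adj G (\<sigma> \<omega> t) $ fst e $ snd e)))" if t: "t \<ge> 0" for t
  proof (rule indep_vars_lebesgue_integral[OF finE])
    have "indep_vars (\<lambda>_. PiM {0..} (\<lambda>_. count_space (UNIV :: real set)))
       (\<lambda>(i, j) \<omega>. restrict (\<lambda>t. adj G (\<sigma> \<omega> t) $ i $ j) {0..}) E"
      using indep unfolding independent_edges_def E_def .
    then have "indep_vars (\<lambda>_. borel)
       (\<lambda>e \<omega>. \<phi> e (((\<lambda>(i, j) \<omega>. restrict (\<lambda>t. adj G (\<sigma> \<omega> t) $ i $ j) {0..}) e \<omega>) t)) E"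
    proof (rule indep_vars_compose2)
      fix e
      have "(\<lambda>f. f t) \<in> measurable (PiM {0..} (\<lambda>_. count_space (UNIV :: real set))) (count_space UNIV)"
        using t by (intro measurable_component_singleton) auto
      then show "(\<lambda>f. \<phi> e (f t)) \<in> measurable (PiM {0..} (\<lambda>_. count_space (UNIV :: real set))) borel"
        by (rule measurable_compose) simp
    qed
    moreover have "(\<lambda>e \<omega>. \<phi> e (((\<lambda>(i, j) \<omega>. restrict (\<lambda>t. adj G (\<sigma> \<omega> t) $ i $ j) {0..}) e \<omega>) t))
      = (\<lambda>e \<omega>. \<phi> e (adj G (\<sigma> \<omega> t) $ fst e $ snd e))"
      using t by (auto simp: fun_eq_iff)
    ultimately show "indep_vars (\<lambda>_. borel) (\<lambda>e \<omega>. \<phi> e (adj G (\<sigma> \<omega> t) $ fst e $ snd e)) E" by simp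
    fix e
    define \<psi> where "\<psi> k = \<phi> e (adj G k $ fst e $ snd e)" for k
    have "integrable M (\<lambda>\<omega>. \<psi> (\<sigma> \<omega> t))"
      by (rule integrable_const_bound[where B = "\<Sum>k\<in>UNIV. \<bar>\<psi> k\<bar>"]) (use abs_le_sum_abs[of \<psi>] in auto)
    then show "integrable M (\<lambda>\<omega>. \<phi> e (adj G (\<sigma> \<omega> t) $ fst e $ snd e))" unfolding \<psi>_def .
  qed
  show "(\<lambda>m. expectation (\<lambda>\<omega>. \<Prod>e\<in>E. \<phi> e (adj G (\<sigma> \<omega> (real m)) $ fst e $ snd e)))
      \<longlonglongrightarrow> (\<Sum>k\<in>UNIV. \<pi> k * (\<Prod>e\<in>{(i, j). j < i}. \<phi> e (adj G k $ fst e $ snd e)))"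
    unfolding E_def by (rule stationary_limit)
  show "(\<lambda>m. expectation (\<lambda>\<omega>. \<Prod>e\<in>E. \<phi> e (adj G (\<sigma> \<omega> (real m)) $ fst e $ snd e)))
      \<longlonglongrightarrow> (\<Prod>e\<in>{(i, j). j < i}. \<Sum>k\<in>UNIV. \<pi> k * \<phi> e (adj G k $ fst e $ snd e))"
    unfolding factor[OF of_nat_0_le_iff] unfolding E_def by (intro tendsto_prod stationary_limit)
qed

lemma (in ergodic_markov) centred_adjacency_independent_entries:
  fixes G :: "'s \<Rightarrow> 'v::{finite,linorder} \<Rightarrow> 'v \<Rightarrow> bool"
  assumes graphs: "simple_graphs G" and indep: "independent_edges M G \<sigma>"
  shows "independent_entries \<pi> (\<lambda>k. adj G k - Abar G \<pi>) (Delta (Abar G \<pi>))"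
proof
  have \<pi>: "\<pi> k \<ge> 0" "(\<Sum>k\<in>UNIV. \<pi> k) = 1" for k
    using stat unfolding stationary_distribution_def by blast+
  have adj01: "adj G k $ i $ j = 0 \<or> adj G k $ i $ j = 1" for k i j by (simp add: adj_def)
  have adj_sym: "adj G k $ i $ j = adj G k $ j $ i" and adj_diag: "adj G k $ i $ i = 0" for k i j
    using graphs unfolding simple_graphs_def adj_def by auto
  have Abar: "Abar G \<pi> $ i $ j = (\<Sum>k\<in>UNIV. \<pi> k * adj G k $ i $ j)" for i j
    unfolding Abar_def by simp
  show "\<pi> k \<ge> 0" "(\<Sum>k\<in>UNIV. \<pi> k) = 1" for k by (fact \<pi>)+
  show "(adj G k - Abar G \<pi>) $ i $ j = (adj G k - Abar G \<pi>) $ j $ i" for k i j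
    using adj_sym by (simp add: Abar)
  show "(adj G k - Abar G \<pi>) $ i $ i = 0" for k i
    using adj_diag by (simp add: Abar)
  have bar01: "0 \<le> Abar G \<pi> $ i $ j" "Abar G \<pi> $ i $ j \<le> 1" for i j
  proof -
    show "0 \<le> Abar G \<pi> $ i $ j" unfolding Abar using \<pi>(1) by (intro sum_nonneg) (auto simp: adj_def)
    have "Abar G \<pi> $ i $ j \<le> (\<Sum>k\<in>UNIV. \<pi> k)"
      unfolding Abar using \<pi>(1) by (intro sum_mono) (auto simp: adj_def)
    then show "Abar G \<pi> $ i $ j \<le> 1" using \<pi>(2) by simp
  qed
  show "\<bar>(adj G k - Abar G \<pi>) $ i $ j\<bar> \<le> 1" for k i j
    using adj01[of k i j] bar01[of i j] by auto
  show "(\<Sum>k\<in>UNIV. \<pi> k * (adj G k - Abar G \<pi>) $ i $ j) = 0" for i j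
    using \<pi>(2) by (simp add: right_diff_distrib sum_subtractf Abar[symmetric] flip: sum_distrib_right)
  show "(\<Sum>j\<in>UNIV. \<Sum>k\<in>UNIV. \<pi> k * ((adj G k - Abar G \<pi>) $ i $ j)\<^sup>2) \<le> Delta (Abar G \<pi>)" for i
  proof -
    have "(\<Sum>k\<in>UNIV. \<pi> k * ((adj G k - Abar G \<pi>) $ i $ j)\<^sup>2) = Abar G \<pi> $ i $ j * (1 - Abar G \<pi> $ i $ j)" for j
    proof -
      define a where "a = Abar G \<pi> $ i $ j"
      have "\<pi> k * ((adj G k - Abar G \<pi>) $ i $ j)\<^sup>2 = \<pi> k * adj G k $ i $ j * (1 - 2 * a) + \<pi> k * a\<^sup>2" for k
        using adj01[of k i j] unfolding a_def by (auto simp: power2_eq_square algebra_simps)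
      then have "(\<Sum>k\<in>UNIV. \<pi> k * ((adj G k - Abar G \<pi>) $ i $ j)\<^sup>2)
          = (\<Sum>k\<in>UNIV. \<pi> k * adj G k $ i $ j) * (1 - 2 * a) + (\<Sum>k\<in>UNIV. \<pi> k) * a\<^sup>2"
        by (simp add: sum.distrib sum_distrib_right)
      also have "\<dots> = a * (1 - a)"
        unfolding \<pi>(2) Abar[symmetric] a_def[symmetric] by (simp add: power2_eq_square algebra_simps)
      finally show ?thesis unfolding a_def .
    qed
    then show ?thesis unfolding Delta_def by (simp only:) (intro Max_ge; simp)
  qed
  show "(\<Sum>k\<in>UNIV. \<pi> k * (\<Prod>e\<in>{(i, j). j < i}. ((adj G k - Abar G \<pi>) $ fst e $ snd e) ^ m e))
      = (\<Prod>e\<in>{(i, j). j < i}. \<Sum>k\<in>UNIV. \<pi> k * ((adj G k - Abar G \<pi>) $ fst e $ snd e) ^ m e)" for m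
    using stationary_edges_independent[OF indep, of "\<lambda>e y. (y - Abar G \<pi> $ fst e $ snd e) ^ m e"] by simp
qed

lemma bernstein_objective_attains_min:
  fixes f :: "real \<Rightarrow> real"
  assumes "D > 0" and "c \<ge> 0" and f: "\<And>s. s \<ge> 0 \<Longrightarrow> f s = s + c * exp (- (3 * s\<^sup>2) / (2 * s + 6 * D))"
  shows "\<exists>s0\<ge>0. \<forall>s\<ge>0. f s0 \<le> f s"
proof -
  have f_ge: "f s \<ge> s" if "s \<ge> 0" for s using f[OF that] \<open>c \<ge> 0\<close> by simp
  have "continuous_on {0..f 0} (\<lambda>s. s + c * exp (- (3 * s\<^sup>2) / (2 * s + 6 * D)))"
    using \<open>D > 0\<close> by (intro continuous_intros) auto
  then have "continuous_on {0..f 0} f" by (rule continuous_on_eq) (simp add: f)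
  moreover have "f 0 \<ge> 0" using f_ge[of 0] by simp
  ultimately obtain s0 where s0: "s0 \<in> {0..f 0}" "\<And>s. s \<in> {0..f 0} \<Longrightarrow> f s0 \<le> f s"
    using continuous_attains_inf[of "{0..f 0}" f] by auto
  have "f s0 \<le> f s" if "s \<ge> 0" for s
    using s0(2)[of s] s0(2)[of 0] f_ge[OF that] \<open>f 0 \<ge> 0\<close> that by (cases "s \<le> f 0") auto
  then show ?thesis using s0(1) by auto
qed

theorem theorem5:
  fixes M :: "'w measure"
    and Pt :: "real \<Rightarrow> 's::finite \<Rightarrow> 's \<Rightarrow> real"
    and \<sigma> :: "'w \<Rightarrow> real \<Rightarrow> 's"
    and \<sigma>0 :: 's
    and G :: "'s \<Rightarrow> 'v::{finite,linorder} \<Rightarrow> 'v \<Rightarrow> bool"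
    and \<beta> \<delta> :: real
    and \<pi> :: "'s \<Rightarrow> real"
    and f :: "real \<Rightarrow> real"
  assumes beta: "\<beta> > 0" and delta: "\<delta> > 0"
    and graphs: "simple_graphs G"
    and markov: "markov_process M Pt \<sigma>"
    and init: "\<forall>\<omega>\<in>space M. \<sigma> \<omega> 0 = \<sigma>0"
    and indep: "independent_edges M G \<sigma>"
    and stat: "stationary_distribution Pt \<pi>"
    and unique: "\<forall>\<pi>'. stationary_distribution Pt \<pi>' \<longrightarrow> \<pi>' = \<pi>"
    and Delta_pos: "Delta (Abar G \<pi>) > 0"
    and f_def: "\<forall>s\<ge>0. f s = s + 2 * real (CARD('v))^2
                   * exp (- (3 * s^2) / (2 * s + 6 * Delta (Abar G \<pi>)))"
  shows "(\<exists>s0\<ge>0. \<forall>s\<ge>0. f s0 \<le> f s) \<and>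
         (lambda_max (Abar G \<pi>) + (INF s\<in>{0..}. f s) < \<delta> / \<beta> \<longrightarrow> as_stable M \<beta> \<delta> G \<sigma>)"
proof (intro conjI impI)
  show min: "\<exists>s0\<ge>0. \<forall>s\<ge>0. f s0 \<le> f s"
    by (rule bernstein_objective_attains_min[OF Delta_pos, of "2 * real (CARD('v))^2"]) (use f_def in auto)
  assume threshold: "lambda_max (Abar G \<pi>) + (INF s\<in>{0..}. f s) < \<delta> / \<beta>"
  interpret ergodic_markov M Pt \<sigma> \<sigma>0 \<pi>
    by unfold_locales (fact markov init stat unique)+
  define X where "X k = adj G k - Abar G \<pi>" for k
  interpret independent_entries \<pi> X "Delta (Abar G \<pi>)"
    unfolding X_def using centred_adjacency_independent_entries[OF graphs indep] .
  have symX: "transpose (X k) = X k" for k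
    by (simp add: vec_eq_iff transpose_def sym)
  have symA: "transpose (Abar G \<pi>) = Abar G \<pi>"
  proof -
    have "adj G k $ i $ j = adj G k $ j $ i" for k i j
      using graphs unfolding simple_graphs_def adj_def by simp
    then show ?thesis by (simp add: vec_eq_iff transpose_def Abar_def)
  qed
  have "\<exists>v \<mu>. norm v = 1 \<and> X k *v v = \<mu> *\<^sub>R v \<and> (\<forall>w. w \<bullet> (X k *v w) \<le> \<mu> * (norm w)\<^sup>2)" for k
    using symmetric_rayleigh_eigenvector[OF symX[of k]] by metis
  then obtain v \<mu> where v: "\<And>k. norm (v k) = 1" "\<And>k. X k *v v k = \<mu> k *\<^sub>R v k"
    and ray: "\<And>k w. w \<bullet> (X k *v w) \<le> \<mu> k * (norm w)\<^sup>2" by metis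
  interpret independent_entries_eigenvalues \<pi> X "Delta (Abar G \<pi>)" v \<mu>
    by unfold_locales (fact v)+
  define \<Lambda> where "\<Lambda> k = lambda_max (Abar G \<pi>) + \<mu> k" for k
  have rayleigh: "w \<bullet> (adj G k *v w) \<le> \<Lambda> k * (norm w)\<^sup>2" for k w
  proof -
    have "adj G k *v w = Abar G \<pi> *v w + X k *v w"
      unfolding X_def by (simp add: matrix_vector_mult_diff_rdistrib)
    then show ?thesis
      using lambda_max_rayleigh[OF symA, of w] ray[of w k] by (simp add: inner_add_right \<Lambda>_def distrib_right)
  qed
  have bdd: "bdd_below (f ` {0..})" using min by (auto intro: bdd_belowI)
  have "(INF s\<in>{0..}. f s) < \<delta> / \<beta> - lambda_max (Abar G \<pi>)" using threshold by simp
  then obtain s where s: "s \<ge> 0" "f s < \<delta> / \<beta> - lambda_max (Abar G \<pi>)"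
    using cINF_less_iff[OF _ bdd] by auto
  define g where "g k = \<beta> * \<Lambda> k - \<delta>" for k
  have "(\<Sum>k\<in>UNIV. \<pi> k * g k) < 0"
  proof -
    have "(\<Sum>k\<in>UNIV. \<pi> k * g k) = \<beta> * (\<Sum>k\<in>UNIV. \<pi> k * \<mu> k) + (\<Sum>k\<in>UNIV. \<pi> k) * (\<beta> * lambda_max (Abar G \<pi>) - \<delta>)"
      unfolding g_def \<Lambda>_def sum_distrib_left sum_distrib_right sum.distrib[symmetric]
      by (intro sum.cong) (auto simp: algebra_simps)
    also have "\<dots> = \<beta> * ((\<Sum>k\<in>UNIV. \<pi> k * \<mu> k) + lambda_max (Abar G \<pi>)) - \<delta>"
      using prob(2) by (simp add: algebra_simps)
    also have "\<dots> \<le> \<beta> * (f s + lambda_max (Abar G \<pi>)) - \<delta>"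
      using expected_eigenvalue_bound[OF Delta_pos s(1)] f_def s(1) beta
      by (intro diff_right_mono mult_left_mono add_right_mono) auto
    also have "\<dots> < 0" using s(2) beta by (simp add: field_simps)
    finally show ?thesis .
  qed
  note drift = negative_mean_path_integral[OF this]
  show "as_stable M \<beta> \<delta> G \<sigma>"
    unfolding as_stable_def
  proof (intro allI impI)
    fix p0 :: "(real, 'v) vec" and p :: "'w \<Rightarrow> real \<Rightarrow> (real, 'v) vec"
    assume p0: "\<forall>i. 0 \<le> p0 $ i \<and> p0 $ i \<le> 1"
      and sol: "\<forall>\<omega>\<in>space M. switched_solution \<beta> \<delta> G (\<sigma> \<omega>) p0 (p \<omega>)"
    from drift show "AE \<omega> in M. ((\<lambda>t. norm (p \<omega> t)) \<longlongrightarrow> 0) at_top"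
    proof (rule AE_mp, intro AE_I2 impI)
      fix \<omega> assume \<omega>: "\<omega> \<in> space M"
        and bot: "filterlim (\<lambda>t. integral {0..t} (\<lambda>s. g (\<sigma> \<omega> s))) at_bot at_top"
      interpret switched_path \<beta> \<delta> G "\<sigma> \<omega>" p0 "p \<omega>"
        by unfold_locales (use beta delta sol \<omega> right_constant p0 in auto)
      have bound: "(norm (p \<omega> t))\<^sup>2 \<le> (norm p0)\<^sup>2 * exp (2 * integral {0..t} (\<lambda>s. g (\<sigma> \<omega> s)))" if "t \<ge> 0" for t
        unfolding g_def by (rule energy_bound[OF rayleigh _ that]) (rule path_integrable[OF \<omega>, of 0 "\<lambda>k. \<beta> * \<Lambda> k - \<delta>"], simp)
      have "filterlim (\<lambda>t. 2 * integral {0..t} (\<lambda>s. g (\<sigma> \<omega> s))) at_bot at_top"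
        by (rule filterlim_tendsto_pos_mult_at_bot[OF tendsto_const _ bot]) simp
      then have "((\<lambda>t. exp (2 * integral {0..t} (\<lambda>s. g (\<sigma> \<omega> s)))) \<longlongrightarrow> 0) at_top"
        by (rule filterlim_compose[OF exp_at_bot])
      then have lim: "((\<lambda>t. (norm p0)\<^sup>2 * exp (2 * integral {0..t} (\<lambda>s. g (\<sigma> \<omega> s)))) \<longlongrightarrow> 0) at_top"
        by (rule tendsto_mult_right_zero)
      have "((\<lambda>t. (norm (p \<omega> t))\<^sup>2) \<longlongrightarrow> 0) at_top"
        by (rule Lim_null_comparison[OF _ lim], rule eventually_mono[OF eventually_ge_at_top[of 0]]) (use bound in simp)
      then show "((\<lambda>t. norm (p \<omega> t)) \<longlongrightarrow> 0) at_top"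
        by (simp add: power_tendsto_0_iff)
    qed
  qed
qed

end
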